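(* Let $M$ be a regular irreducible algebraic submonoid of $M_n(\mathbb{C})$ and let $e\in M$ be an idempotent. Then $$\dim E(D_e^M)=\dim E(L_e^M)+\dim E(R_e^M).$$
   Context: $M_n(\mathbb{C})$ is the multiplicative monoid of $n\times n$ complex matrices, identified with $\mathbb{C}^{n^2}$. An algebraic submonoid $M$ of $M_n(\mathbb{C})$ is a submonoid (containing the identity matrix) that is the zero set of a collection of polynomials in the matrix entries; it is irreducible if it is not the union of two proper algebraic subsets, and regular if for every $a\in M$ there is $x\in M$ with $axa=a$. Green's relations in $M$: $a\,\mathscr L^M\, b$ iff $Ma=Mb$; $a\,\mathscr R^M\, b$ iff $aM=bM$; $\mathscr D^M$ is the smallest equivalence relation containing both; $L_e^M,R_e^M,D_e^M$ are the corresponding classes of $e$. $E(T)$ denotes the set of idempotents in $T$; $E(D_e^M)$, $E(L_e^M)$ and $E(R_e^M)$ are (embedded, complex analytic) submanifolds of $M_n(\mathbb{C})$ in the euclidean topology, and $\dim$ is the (complex) dimension as a manifold. *)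

theory Defs
  imports "HOL-Analysis.Analysis"
begin

section \<open>Algebraic subsets of complex affine space\<close>

text \<open>Polynomials in the coordinates of \<open>\<complex>\<^sup>m\<close>, as functions.\<close>

inductive polynomial_fun :: "(complex ^ 'm \<Rightarrow> complex) \<Rightarrow> bool" where
  const: "polynomial_fun (\<lambda>x. c)"
| coord: "polynomial_fun (\<lambda>x. x $ k)"
| add: "polynomial_fun p \<Longrightarrow> polynomial_fun q \<Longrightarrow> polynomial_fun (\<lambda>x. p x + q x)"
| mult: "polynomial_fun p \<Longrightarrow> polynomial_fun q \<Longrightarrow> polynomial_fun (\<lambda>x. p x * q x)"

definition algebraic_set :: "(complex ^ 'm) set \<Rightarrow> bool" where
  "algebraic_set Z \<longleftrightarrow>
     (\<exists>P. (\<forall>p\<in>P. polynomial_fun p) \<and> Z = {x. \<forall>p\<in>P. p x = 0})"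

definition irreducible_set :: "(complex ^ 'm) set \<Rightarrow> bool" where
  "irreducible_set Z \<longleftrightarrow>
     \<not> (\<exists>A B. algebraic_set A \<and> algebraic_set B \<and> A \<subset> Z \<and> B \<subset> Z \<and> Z = A \<union> B)"


section \<open>Embedded complex submanifolds\<close>

text \<open>A map in several complex variables is holomorphic if it is (Frechet) differentiable
  with complex linear derivative at every point.\<close>

definition holomorphic_map_on ::
  "(complex ^ 'm \<Rightarrow> complex ^ 'k) \<Rightarrow> (complex ^ 'm) set \<Rightarrow> bool" where
  "holomorphic_map_on f U \<longleftrightarrow>
     (\<forall>x\<in>U. \<exists>f'. (f has_derivative f') (at x) \<and> Vector_Spaces.linear (*s) (*s) f')"

definition biholomorphic_map ::
  "(complex ^ 'm) set \<Rightarrow> (complex ^ 'm) set \<Rightarrow> (complex ^ 'm \<Rightarrow> complex ^ 'm) \<Rightarrow> bool" where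
  "biholomorphic_map U V \<phi> \<longleftrightarrow>
     open U \<and> open V \<and> \<phi> ` U = V \<and> holomorphic_map_on \<phi> U \<and>
     (\<exists>\<psi>. holomorphic_map_on \<psi> V \<and> (\<forall>x\<in>U. \<psi> (\<phi> x) = x))"

text \<open>Slice charts: locally \<open>S\<close> is carried to the coordinate subspace spanned by the
  \<open>d\<close> coordinates in \<open>I\<close>.\<close>

definition complex_submanifold :: "nat \<Rightarrow> (complex ^ 'm) set \<Rightarrow> bool" where
  "complex_submanifold d S \<longleftrightarrow>
     (\<forall>p\<in>S. \<exists>U V \<phi> I. p \<in> U \<and> biholomorphic_map U V \<phi> \<and> card I = d \<and>
        \<phi> ` (S \<inter> U) = V \<inter> {y. \<forall>k. k \<notin> I \<longrightarrow> y $ k = 0})"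

text \<open>Only meaningful for nonempty submanifolds, where the dimension is unique.\<close>

definition complex_dim :: "(complex ^ 'm) set \<Rightarrow> nat" where
  "complex_dim S = (THE d. complex_submanifold d S)"


section \<open>Monoids of matrices\<close>

text \<open>The identification of the \<open>n \<times> n\<close> matrices with \<open>\<complex>\<^bsup>n\<^sup>2\<^esup>\<close>.\<close>

definition entries :: "complex ^ 'n ^ 'n \<Rightarrow> complex ^ ('n \<times> 'n)" where
  "entries A = (\<chi> k. A $ fst k $ snd k)"

definition matrix_submonoid :: "(complex ^ 'n ^ 'n) set \<Rightarrow> bool" where
  "matrix_submonoid M \<longleftrightarrow> mat 1 \<in> M \<and> (\<forall>a\<in>M. \<forall>b\<in>M. a ** b \<in> M)"

definition algebraic_submonoid :: "(complex ^ 'n ^ 'n) set \<Rightarrow> bool" where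
  "algebraic_submonoid M \<longleftrightarrow> matrix_submonoid M \<and> algebraic_set (entries ` M)"

definition irreducible_submonoid :: "(complex ^ 'n ^ 'n) set \<Rightarrow> bool" where
  "irreducible_submonoid M \<longleftrightarrow> irreducible_set (entries ` M)"

definition regular_submonoid :: "(complex ^ 'n ^ 'n) set \<Rightarrow> bool" where
  "regular_submonoid M \<longleftrightarrow> (\<forall>a\<in>M. \<exists>x\<in>M. a ** x ** a = a)"

definition idempotents :: "(complex ^ 'n ^ 'n) set \<Rightarrow> (complex ^ 'n ^ 'n) set" where
  "idempotents T = {f \<in> T. f ** f = f}"

definition green_L :: "(complex ^ 'n ^ 'n) set \<Rightarrow> (complex ^ 'n ^ 'n) rel" where
  "green_L M = {(a, b). a \<in> M \<and> b \<in> M \<and> (\<lambda>x. x ** a) ` M = (\<lambda>x. x ** b) ` M}"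

definition green_R :: "(complex ^ 'n ^ 'n) set \<Rightarrow> (complex ^ 'n ^ 'n) rel" where
  "green_R M = {(a, b). a \<in> M \<and> b \<in> M \<and> (\<lambda>x. a ** x) ` M = (\<lambda>x. b ** x) ` M}"

definition green_D :: "(complex ^ 'n ^ 'n) set \<Rightarrow> (complex ^ 'n ^ 'n) rel" where
  "green_D M = \<Inter> {r. equiv M r \<and> green_L M \<subseteq> r \<and> green_R M \<subseteq> r}"

definition L_class :: "(complex ^ 'n ^ 'n) set \<Rightarrow> complex ^ 'n ^ 'n \<Rightarrow> (complex ^ 'n ^ 'n) set" where
  "L_class M e = green_L M `` {e}"

definition R_class :: "(complex ^ 'n ^ 'n) set \<Rightarrow> complex ^ 'n ^ 'n \<Rightarrow> (complex ^ 'n ^ 'n) set" where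
  "R_class M e = green_R M `` {e}"

definition D_class :: "(complex ^ 'n ^ 'n) set \<Rightarrow> complex ^ 'n ^ 'n \<Rightarrow> (complex ^ 'n ^ 'n) set" where
  "D_class M e = green_D M `` {e}"

end

theory Submission
  imports Defs "HOL-Complex_Analysis.Cauchy_Integral_Formula"
begin

text \<open>The dimension formula is local. Let \<open>x\<close> be an idempotent of \<open>M\<close> near \<open>e\<close>, and let \<open>u\<close> be the
  inverse of \<open>e ** x ** e\<close> in the corner \<open>e ** M ** e\<close>. It lies in \<open>M\<close> because \<open>M\<close> is regular. Then
  \<open>x ** u\<close> is the idempotent with the image of \<open>x\<close> and the kernel of \<open>e\<close>, so it lies in the
  \<open>\<L>\<close>-class of \<open>e\<close>; \<open>u ** x\<close> has the image of \<open>e\<close> and the kernel of \<open>x\<close>, so it lies in the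
  \<open>\<R>\<close>-class of \<open>e\<close>; and \<open>x\<close> is recovered from these two by the rational expression
  \<open>k ** (corner_inv e (h ** k) ** h)\<close>. Hence near \<open>e\<close> the idempotents of \<open>M\<close> all lie in the
  \<open>\<D>\<close>-class of \<open>e\<close> and form the product of \<open>E(L\<^sub>e)\<close> and \<open>E(R\<^sub>e)\<close> (\<open>germ_iso_D_class\<close>).
  What remains is that all the sets concerned are manifolds, of the same dimension everywhere.

  The set \<open>E(L\<^sub>e) = {k \<in> M. e ** k = e \<and> k ** e = k}\<close> is algebraic. An algebraic set is a manifold of
  one fixed dimension at the points where some polynomial that is not identically zero on it does not
  vanish (\<open>algebraic_set_generically_manifold\<close>). From there irreducibility carries smoothness to each
  \<open>f \<in> E(L\<^sub>e)\<close>: a generic invertible \<open>a \<in> M\<close> moves \<open>f\<close> to an idempotent \<open>h \<in> E(L\<^sub>e)\<close> with the same image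
  as \<open>a ** f ** inv a\<close>, and \<open>h\<close> avoids the zeros of that polynomial. Conjugation by \<open>a\<close> is an
  isomorphism onto the corresponding set at \<open>a ** f ** inv a\<close>, and the germs of \<open>E(L\<^sub>f)\<close> at \<open>f\<close> and of
  \<open>E(L\<^sub>g)\<close> at \<open>g\<close> are isomorphic whenever \<open>f\<close> and \<open>g\<close> have the same image
  (\<open>germ_iso_right_related\<close>, \<open>left_idempotents_manifold\<close>). The case of \<open>E(R\<^sub>e)\<close> follows by transposition.

  Finally the two dimensions are constant on a \<open>\<D>\<close>-class. If \<open>f \<L> a \<R> g\<close>, then after
  multiplication of \<open>a\<close> by a generic invertible \<open>y \<in> M\<close> its \<open>\<H>\<close>-class contains an idempotent,
  which links \<open>g\<close> to a conjugate of \<open>f\<close> (\<open>dims_D_related\<close>).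

  Isomorphisms of germs are given by holomorphic maps of neighbourhoods in the ambient spaces that are
  mutually inverse on the given sets only. So rational expressions for the maps suffice, also between
  ambient spaces of different dimensions. Such an isomorphism onto a coordinate subspace yields a
  slice chart, by the inverse function theorem (\<open>slice_chart\<close>).\<close>

section \<open>Continuously differentiable holomorphic maps\<close>

text \<open>Continuity of the derivative is part of the notion because the inverse function theorem
  requires it.\<close>
definition hol_fun_on :: "(complex ^ 'm) set \<Rightarrow> (complex ^ 'm \<Rightarrow> complex) \<Rightarrow> bool" where
  "hol_fun_on U f \<longleftrightarrow>
     (\<exists>J :: complex ^ 'm \<Rightarrow> complex ^ 'm. continuous_on U J \<and>
        (\<forall>x\<in>U. (f has_derivative (\<lambda>v. \<Sum>k\<in>UNIV. J x $ k * v $ k)) (at x)))"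

definition hol_map_on :: "(complex ^ 'm) set \<Rightarrow> (complex ^ 'm \<Rightarrow> complex ^ 'k) \<Rightarrow> bool" where
  "hol_map_on U F \<longleftrightarrow>
     (\<exists>J :: complex ^ 'm \<Rightarrow> complex ^ 'm ^ 'k. continuous_on U J \<and>
        (\<forall>x\<in>U. (F has_derivative (\<lambda>v. J x *v v)) (at x)))"

lemma has_derivative_imp_continuous_on:
  assumes "\<And>x. x \<in> U \<Longrightarrow> (f has_derivative f' x) (at x)"
  shows "continuous_on U f"
  using assms by (intro continuous_at_imp_continuous_on ballI) (rule has_derivative_continuous)

lemma has_derivative_vec_componentwise:
  fixes F :: "'a::real_normed_vector \<Rightarrow> complex ^ 'k"
  shows "(F has_derivative F') (at x) \<longleftrightarrow> (\<forall>k. ((\<lambda>x. F x $ k) has_derivative (\<lambda>v. F' v $ k)) (at x))"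
proof
  assume "(F has_derivative F') (at x)"
  then show "\<forall>k. ((\<lambda>x. F x $ k) has_derivative (\<lambda>v. F' v $ k)) (at x)"
    using bounded_linear.has_derivative[OF bounded_linear_vec_nth] by blast
next
  assume *: "\<forall>k. ((\<lambda>x. F x $ k) has_derivative (\<lambda>v. F' v $ k)) (at x)"
  show "(F has_derivative F') (at x)"
    unfolding has_derivative_componentwise_within[where f = F and S = UNIV]
  proof
    fix i :: "complex ^ 'k" assume "i \<in> Basis"
    then obtain k b where i: "i = axis k b"
      by (auto simp: Basis_vec_def)
    have "((\<lambda>x. F x $ k \<bullet> b) has_derivative (\<lambda>v. F' v $ k \<bullet> b)) (at x)"
      using * by (intro has_derivative_inner_left) auto
    then show "((\<lambda>x. F x \<bullet> i) has_derivative (\<lambda>x. F' x \<bullet> i)) (at x)"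
      by (simp add: i inner_axis)
  qed
qed

lemma hol_map_on_iff: "hol_map_on U F \<longleftrightarrow> (\<forall>k. hol_fun_on U (\<lambda>x. F x $ k))"
proof
  assume "hol_map_on U F"
  then obtain J where J: "continuous_on U J" "\<And>x. x \<in> U \<Longrightarrow> (F has_derivative (\<lambda>v. J x *v v)) (at x)"
    unfolding hol_map_on_def by blast
  show "\<forall>k. hol_fun_on U (\<lambda>x. F x $ k)"
  proof
    fix k
    have "((\<lambda>x. F x $ k) has_derivative (\<lambda>v. \<Sum>l\<in>UNIV. J x $ k $ l * v $ l)) (at x)" if "x \<in> U" for x
      using J(2)[OF that] by (simp add: has_derivative_vec_componentwise matrix_vector_mult_def)
    moreover have "continuous_on U (\<lambda>x. J x $ k)"
      using J(1) by (intro continuous_intros)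
    ultimately show "hol_fun_on U (\<lambda>x. F x $ k)"
      unfolding hol_fun_on_def by (intro exI[of _ "\<lambda>x. J x $ k"]) auto
  qed
next
  assume "\<forall>k. hol_fun_on U (\<lambda>x. F x $ k)"
  then have "\<forall>k. \<exists>J. continuous_on U J \<and>
        (\<forall>x\<in>U. ((\<lambda>x. F x $ k) has_derivative (\<lambda>v. \<Sum>l\<in>UNIV. J x $ l * v $ l)) (at x))"
    unfolding hol_fun_on_def .
  from choice[OF this] obtain J where J: "\<And>k. continuous_on U (J k)"
     "\<And>k x. x \<in> U \<Longrightarrow> ((\<lambda>x. F x $ k) has_derivative (\<lambda>v. \<Sum>l\<in>UNIV. J k x $ l * v $ l)) (at x)"
    by auto
  have "(F has_derivative (\<lambda>v. (\<chi> k. J k x) *v v)) (at x)" if "x \<in> U" for x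
    using J(2)[OF that] by (simp add: has_derivative_vec_componentwise matrix_vector_mult_def)
  moreover have "continuous_on U (\<lambda>x. \<chi> k. J k x)"
    using J(1) by (intro continuous_intros)
  ultimately show "hol_map_on U F"
    unfolding hol_map_on_def by (intro exI[of _ "\<lambda>x. \<chi> k. J k x"]) auto
qed

lemma hol_map_onD: "hol_map_on U F \<Longrightarrow> hol_fun_on U (\<lambda>x. F x $ k)"
  by (simp add: hol_map_on_iff)

lemma hol_fun_on_subset: "hol_fun_on U f \<Longrightarrow> W \<subseteq> U \<Longrightarrow> hol_fun_on W f"
  unfolding hol_fun_on_def using continuous_on_subset by blast

lemma hol_map_on_subset: "hol_map_on U f \<Longrightarrow> W \<subseteq> U \<Longrightarrow> hol_map_on W f"
  unfolding hol_map_on_def using continuous_on_subset by blast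

lemma hol_fun_on_const [intro]: "hol_fun_on U (\<lambda>x. c)"
  unfolding hol_fun_on_def by (rule exI[of _ "\<lambda>_. 0"]) auto

lemma hol_fun_on_coord [intro]: "hol_fun_on U (\<lambda>x :: complex ^ 'm. x $ k)"
proof -
  have "((\<lambda>x. x $ k) has_derivative (\<lambda>v. \<Sum>l\<in>UNIV. axis k 1 $ l * v $ l)) (at x)" for x :: "complex ^ 'm"
  proof -
    have "(\<lambda>v. \<Sum>l\<in>UNIV. axis k 1 $ l * v $ l) = (\<lambda>v :: complex ^ 'm. v $ k)"
      by (auto simp: axis_def if_distrib[where f = "\<lambda>a. a * _"] cong: if_cong)
    then show ?thesis
      using bounded_linear_imp_has_derivative[OF bounded_linear_vec_nth] by metis
  qed
  then show ?thesis
    unfolding hol_fun_on_def by (intro exI[of _ "\<lambda>_. axis k 1"]) auto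
qed

lemma hol_fun_on_add [intro]:
  assumes "hol_fun_on U f" "hol_fun_on U g"
  shows "hol_fun_on U (\<lambda>x. f x + g x)"
proof -
  obtain J K where "continuous_on U J" "continuous_on U K"
    and JK: "\<And>x. x \<in> U \<Longrightarrow> (f has_derivative (\<lambda>v. \<Sum>k\<in>UNIV. J x $ k * v $ k)) (at x)"
      "\<And>x. x \<in> U \<Longrightarrow> (g has_derivative (\<lambda>v. \<Sum>k\<in>UNIV. K x $ k * v $ k)) (at x)"
    using assms unfolding hol_fun_on_def by blast
  then have "continuous_on U (\<lambda>x. J x + K x)"
    by (intro continuous_intros)
  moreover have "((\<lambda>x. f x + g x) has_derivative (\<lambda>v. \<Sum>k\<in>UNIV. (J x + K x) $ k * v $ k)) (at x)"
    if "x \<in> U" for x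
    using has_derivative_add[OF JK(1)[OF that] JK(2)[OF that]]
    by (simp add: sum.distrib distrib_right)
  ultimately show ?thesis
    unfolding hol_fun_on_def by (intro exI[of _ "\<lambda>x. J x + K x"]) auto
qed

lemma hol_fun_on_mult [intro]:
  assumes "hol_fun_on U f" "hol_fun_on U g"
  shows "hol_fun_on U (\<lambda>x. f x * g x)"
proof -
  obtain J K where c: "continuous_on U J" "continuous_on U K"
    and JK: "\<And>x. x \<in> U \<Longrightarrow> (f has_derivative (\<lambda>v. \<Sum>k\<in>UNIV. J x $ k * v $ k)) (at x)"
      "\<And>x. x \<in> U \<Longrightarrow> (g has_derivative (\<lambda>v. \<Sum>k\<in>UNIV. K x $ k * v $ k)) (at x)"
    using assms unfolding hol_fun_on_def by blast
  have "continuous_on U f" "continuous_on U g"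
    by (rule has_derivative_imp_continuous_on, erule JK)+
  with c have "continuous_on U (\<lambda>x. f x *s K x + g x *s J x)"
    unfolding vector_scalar_mult_def by (intro continuous_intros)
  moreover have "((\<lambda>x. f x * g x) has_derivative (\<lambda>v. \<Sum>k\<in>UNIV. (f x *s K x + g x *s J x) $ k * v $ k)) (at x)"
    if "x \<in> U" for x
    using has_derivative_mult[OF JK(1)[OF that] JK(2)[OF that]]
    by (simp add: sum.distrib sum_distrib_left sum_distrib_right algebra_simps)
  ultimately show ?thesis
    unfolding hol_fun_on_def by (intro exI[of _ "\<lambda>x. f x *s K x + g x *s J x"]) auto
qed

lemma hol_fun_on_inverse [intro]:
  assumes "hol_fun_on U f" "\<And>x. x \<in> U \<Longrightarrow> f x \<noteq> 0"
  shows "hol_fun_on U (\<lambda>x. inverse (f x))"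
proof -
  obtain J where c: "continuous_on U J"
    and J: "\<And>x. x \<in> U \<Longrightarrow> (f has_derivative (\<lambda>v. \<Sum>k\<in>UNIV. J x $ k * v $ k)) (at x)"
    using assms unfolding hol_fun_on_def by blast
  have "continuous_on U f"
    by (rule has_derivative_imp_continuous_on, erule J)
  with c assms(2) have "continuous_on U (\<lambda>x. (- inverse (f x) * inverse (f x)) *s J x)"
    unfolding vector_scalar_mult_def by (intro continuous_intros) auto
  moreover have "((\<lambda>x. inverse (f x)) has_derivative
      (\<lambda>v. \<Sum>k\<in>UNIV. ((- inverse (f x) * inverse (f x)) *s J x) $ k * v $ k)) (at x)"
    if "x \<in> U" for x
    using Deriv.has_derivative_inverse[OF assms(2)[OF that] J[OF that]]
    by (simp add: sum_distrib_left sum_distrib_right sum_negf mult_ac)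
  ultimately show ?thesis
    unfolding hol_fun_on_def by (intro exI[of _ "\<lambda>x. (- inverse (f x) * inverse (f x)) *s J x"]) auto
qed

lemma hol_fun_on_uminus [intro]: "hol_fun_on U f \<Longrightarrow> hol_fun_on U (\<lambda>x. - f x)"
  using hol_fun_on_mult[OF hol_fun_on_const[of U "-1"]] by simp

lemma hol_fun_on_diff [intro]: "hol_fun_on U f \<Longrightarrow> hol_fun_on U g \<Longrightarrow> hol_fun_on U (\<lambda>x. f x - g x)"
  using hol_fun_on_add[OF _ hol_fun_on_uminus, of U f g] by simp

lemma hol_fun_on_divide [intro]:
  "hol_fun_on U f \<Longrightarrow> hol_fun_on U g \<Longrightarrow> (\<And>x. x \<in> U \<Longrightarrow> g x \<noteq> 0) \<Longrightarrow> hol_fun_on U (\<lambda>x. f x / g x)"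
  unfolding divide_inverse by (intro hol_fun_on_mult hol_fun_on_inverse)

lemma hol_fun_on_sum [intro]: "(\<And>a. a \<in> A \<Longrightarrow> hol_fun_on U (f a)) \<Longrightarrow> hol_fun_on U (\<lambda>x. \<Sum>a\<in>A. f a x)"
  by (induction A rule: infinite_finite_induct) auto

lemma hol_fun_on_prod [intro]: "(\<And>a. a \<in> A \<Longrightarrow> hol_fun_on U (f a)) \<Longrightarrow> hol_fun_on U (\<lambda>x. \<Prod>a\<in>A. f a x)"
  by (induction A rule: infinite_finite_induct) auto

lemma hol_fun_on_cong: 
  assumes "open U" "hol_fun_on U f" "\<And>x. x \<in> U \<Longrightarrow> f x = g x"
  shows "hol_fun_on U g"
proof -
  obtain J where c: "continuous_on U J"
    and J: "\<And>x. x \<in> U \<Longrightarrow> (f has_derivative (\<lambda>v. \<Sum>k\<in>UNIV. J x $ k * v $ k)) (at x)"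
    using assms unfolding hol_fun_on_def by blast
  have "(g has_derivative (\<lambda>v. \<Sum>k\<in>UNIV. J x $ k * v $ k)) (at x)" if "x \<in> U" for x
    using has_derivative_transform_within_open[OF J[OF that] assms(1) that] assms(3) by metis
  with c show ?thesis
    unfolding hol_fun_on_def by blast
qed

lemma hol_map_on_compose:
  fixes F :: "complex ^ 'm \<Rightarrow> complex ^ 'k"
  assumes "hol_map_on V G" "hol_map_on U F" "F ` U \<subseteq> V"
  shows "hol_map_on U (\<lambda>x. G (F x))"
proof -
  obtain J K where c: "continuous_on V J" "continuous_on U K"
    and J: "\<And>x. x \<in> V \<Longrightarrow> (G has_derivative (\<lambda>v. J x *v v)) (at x)"
    and K: "\<And>x. x \<in> U \<Longrightarrow> (F has_derivative (\<lambda>v. K x *v v)) (at x)"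
    using assms unfolding hol_map_on_def by blast
  have "continuous_on U F"
    by (rule has_derivative_imp_continuous_on, erule K)
  then have "continuous_on U (\<lambda>x. J (F x))"
    using continuous_on_compose2 c(1) assms(3) by blast
  then have "continuous_on U (\<lambda>x. J (F x) ** K x)"
    using c(2) unfolding matrix_matrix_mult_def by (intro continuous_intros)
  moreover have "((\<lambda>x. G (F x)) has_derivative (\<lambda>v. (J (F x) ** K x) *v v)) (at x)" if "x \<in> U" for x
    using diff_chain_at[OF K[OF that] J[of "F x"]] that assms(3)
    by (simp add: o_def matrix_vector_mul_assoc image_subset_iff)
  ultimately show ?thesis
    unfolding hol_map_on_def by (intro exI[of _ "\<lambda>x. J (F x) ** K x"]) auto
qed

lemma hol_map_on_continuous: "hol_map_on U F \<Longrightarrow> continuous_on U F"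
  unfolding hol_map_on_def by (elim exE conjE) (rule has_derivative_imp_continuous_on, erule bspec)

lemma hol_fun_on_continuous: "hol_fun_on U f \<Longrightarrow> continuous_on U f"
  unfolding hol_fun_on_def by (elim exE conjE) (rule has_derivative_imp_continuous_on, erule bspec)

lemma hol_map_on_id: "hol_map_on U (\<lambda>x. x)"
  by (auto simp: hol_map_on_iff)

lemma hol_map_on_imp_holomorphic_map_on: "hol_map_on U F \<Longrightarrow> holomorphic_map_on F U"
  unfolding hol_map_on_def holomorphic_map_on_def using matrix_vector_mul_linear_gen by blast

lemma hol_fun_on_det:
  fixes A :: "complex ^ 'm \<Rightarrow> complex ^ 'n ^ 'n"
  assumes "\<And>i j. hol_fun_on U (\<lambda>x. A x $ i $ j)"
  shows "hol_fun_on U (\<lambda>x. det (A x))"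
  unfolding det_def using assms by (intro hol_fun_on_sum hol_fun_on_mult hol_fun_on_prod hol_fun_on_const)

lemma matrix_inv_right: 
  fixes A :: "complex ^ 'n ^ 'n"
  assumes "det A \<noteq> 0"
  shows "A ** matrix_inv A = mat 1"
proof -
  have "\<exists>B. A ** B = mat 1 \<and> B ** A = mat 1"
    using assms unfolding invertible_det_nz[symmetric] invertible_def .
  from someI_ex[OF this] show ?thesis
    unfolding matrix_inv_def by blast
qed

lemma matrix_inv_left: 
  fixes A :: "complex ^ 'n ^ 'n"
  assumes "det A \<noteq> 0"
  shows "matrix_inv A ** A = mat 1"
  using matrix_inv_right[OF assms] matrix_left_right_inverse by blast

text \<open>The entries are the determinants of Cramer's rule, so that the inverse of a matrix is visibly a
  rational function of its entries.\<close>
definition adjugate :: "complex ^ 'n ^ 'n \<Rightarrow> complex ^ 'n ^ 'n" where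
  "adjugate A = (\<chi> k l. det (\<chi> i j. if j = k then (if i = l then 1 else 0) else A $ i $ j))"

lemma matrix_inv_adjugate:
  fixes A :: "complex ^ 'n ^ 'n"
  assumes "det A \<noteq> 0"
  shows "matrix_inv A = (\<chi> k l. adjugate A $ k $ l / det A)"
proof -
  have "matrix_inv A $ k $ l = adjugate A $ k $ l / det A" for k l
  proof -
    have "A ** matrix_inv A = mat 1"
      using assms by (simp add: matrix_inv_right)
    then have "A *v (matrix_inv A *v axis l 1) = axis l 1"
      by (simp add: matrix_vector_mul_assoc)
    then have "matrix_inv A *v axis l 1 = (\<chi> k. det (\<chi> i j. if j = k then axis l 1 $ i else A $ i $ j) / det A)"
      using cramer[OF assms] by blast
    then have "(matrix_inv A *v axis l 1) $ k = det (\<chi> i j. if j = k then axis l 1 $ i else A $ i $ j) / det A"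
      by simp
    moreover have "(matrix_inv A *v axis l 1) $ k = matrix_inv A $ k $ l"
      by (simp add: matrix_vector_mult_def axis_def if_distrib cong: if_cong)
    moreover have "axis l 1 $ i = (if i = l then 1 else 0 :: complex)" for i
      by (simp add: axis_def)
    ultimately show "matrix_inv A $ k $ l = adjugate A $ k $ l / det A"
      by (simp add: adjugate_def cong: if_cong)
  qed
  then show ?thesis
    by (simp add: vec_eq_iff)
qed

lemma hol_fun_on_matrix_inv:
  fixes A :: "complex ^ 'm \<Rightarrow> complex ^ 'n ^ 'n"
  assumes "open U" and A: "\<And>i j. hol_fun_on U (\<lambda>x. A x $ i $ j)" and nz: "\<And>x. x \<in> U \<Longrightarrow> det (A x) \<noteq> 0"
  shows "hol_fun_on U (\<lambda>x. matrix_inv (A x) $ k $ l)"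
proof -
  have "hol_fun_on U (\<lambda>x. adjugate (A x) $ k $ l)"
    unfolding adjugate_def vec_lambda_beta
  proof (rule hol_fun_on_det)
    fix i j show "hol_fun_on U (\<lambda>x. (\<chi> i j. if j = k then (if i = l then 1 else 0) else A x $ i $ j) $ i $ j)"
      using A by (cases "j = k"; cases "i = l") auto
  qed
  then have "hol_fun_on U (\<lambda>x. adjugate (A x) $ k $ l / det (A x))"
    using A nz by (intro hol_fun_on_divide hol_fun_on_det)
  from hol_fun_on_cong[OF assms(1) this] show ?thesis
    using nz by (simp add: matrix_inv_adjugate)
qed

text \<open>The real inverse function theorem provides a local inverse with the inverse derivative. That
  derivative is given by a complex matrix, hence complex linear, and it is continuous by
  Cramer's rule.\<close>
lemma hol_map_inverse_function:
  fixes F :: "complex ^ 'm \<Rightarrow> complex ^ 'm"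
  assumes "open U" "p \<in> U" "hol_map_on U F"
    and "(F has_derivative (\<lambda>v. A *v v)) (at p)" "det A \<noteq> 0"
  obtains U' V G where "open U'" "U' \<subseteq> U" "p \<in> U'" "open V" "F ` U' = V" "hol_map_on V G"
    "\<forall>x\<in>U'. G (F x) = x" "\<forall>y\<in>V. G y \<in> U' \<and> F (G y) = y"
proof -
  obtain J where J: "continuous_on U J" "\<And>x. x \<in> U \<Longrightarrow> (F has_derivative (\<lambda>v. J x *v v)) (at x)"
    using assms(3) unfolding hol_map_on_def by blast
  define U0 where "U0 = {x \<in> U. det (J x) \<noteq> 0}"
  have cd: "continuous_on U (\<lambda>x. det (J x))"
    using J(1) unfolding det_def by (intro continuous_intros)
  have "open U0"
    using continuous_open_preimage[OF cd assms(1), of "- {0}"]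
    by (simp add: U0_def Int_def vimage_def open_Compl)
  have "(\<lambda>v. J p *v v) = (\<lambda>v. A *v v)"
    using has_derivative_unique[OF J(2)[OF assms(2)] assms(4)] .
  then have "J p = A"
    by (metis matrix_of_matrix_vector_mul)
  with assms(2,5) have p0: "p \<in> U0"
    by (simp add: U0_def)
  define f' where "f' x = Blinfun (\<lambda>v. J x *v v)" for x
  have f'[simp]: "blinfun_apply (f' x) = (\<lambda>v. J x *v v)" for x
    unfolding f'_def by (simp add: bounded_linear_Blinfun_apply)
  have cf: "continuous_on U0 f'"
  proof (rule continuous_on_blinfun_componentwise)
    fix i :: "complex ^ 'm"
    have "continuous_on U0 J"
      using J(1) continuous_on_subset[of U J U0] by (auto simp: U0_def)
    then show "continuous_on U0 (\<lambda>x. f' x i)"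
      unfolding f' matrix_vector_mult_def by (intro continuous_intros)
  qed
  have inv: "Blinfun (\<lambda>v. matrix_inv A *v v) o\<^sub>L f' p = id_blinfun"
  proof (rule blinfun_eqI)
    fix v
    have "matrix_inv A ** A = mat 1"
      using assms(5) by (simp add: matrix_inv_left)
    then show "(Blinfun (\<lambda>v. matrix_inv A *v v) o\<^sub>L f' p) v = id_blinfun v"
      by (simp add: bounded_linear_Blinfun_apply \<open>J p = A\<close> matrix_vector_mul_assoc)
  qed
  have derf: "(F has_derivative blinfun_apply (f' x)) (at x)" if "x \<in> U0" for x
    using J(2) that by (simp add: U0_def)
  obtain U' V G g' where *: "open U'" "U' \<subseteq> U0" "p \<in> U'" "open V" "F p \<in> V" "homeomorphism U' V F G"
    "\<And>y. y \<in> V \<Longrightarrow> (G has_derivative (g' y)) (at y)"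
    "\<And>y. y \<in> V \<Longrightarrow> g' y = inv (blinfun_apply (f' (G y)))"
  proof (rule inverse_function_theorem[OF \<open>open U0\<close> derf cf p0 inv])
    fix U' V g g'
    assume "open U'" "U' \<subseteq> U0" "p \<in> U'" "open V" "F p \<in> V" "homeomorphism U' V F g"
      "\<And>y. y \<in> V \<Longrightarrow> (g has_derivative (g' y)) (at y)"
      "\<And>y. y \<in> V \<Longrightarrow> g' y = inv (blinfun_apply (f' (g y)))"
    then show thesis
      by (rule that)
  qed
  have hom: "F ` U' = V" "\<forall>x\<in>U'. G (F x) = x" "\<forall>y\<in>V. G y \<in> U' \<and> F (G y) = y"
      "continuous_on V G"
    using *(6) by (auto simp: homeomorphism_def)
  have GU: "G ` V \<subseteq> U0"
    using hom(3) *(2) by auto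
  then have "continuous_on V (\<lambda>y. J (G y))"
    using continuous_on_compose2[OF J(1) hom(4)] by (auto simp: U0_def)
  have g'_eq: "g' y = (\<lambda>v. matrix_inv (J (G y)) *v v)" if "y \<in> V" for y
  proof -
    have "det (J (G y)) \<noteq> 0"
      using GU that by (auto simp: U0_def)
    then have 1: "matrix_inv (J (G y)) ** J (G y) = mat 1" "J (G y) ** matrix_inv (J (G y)) = mat 1"
      by (auto simp: matrix_inv_left matrix_inv_right)
    have "inv (\<lambda>v. J (G y) *v v) = (\<lambda>v. matrix_inv (J (G y)) *v v)"
      by (rule inv_unique_comp) (auto simp: fun_eq_iff matrix_vector_mul_assoc 1)
    then show ?thesis
      using *(8)[OF that] by simp
  qed
  have nz: "det (J (G y)) \<noteq> 0" if "y \<in> V" for y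
    using GU that by (auto simp: U0_def)
  have cont_det: "continuous_on V (\<lambda>x. det (B x))" if "\<And>i j. continuous_on V (\<lambda>x. B x $ i $ j)"
    for B :: "complex ^ 'm \<Rightarrow> complex ^ 'm ^ 'm"
    unfolding det_def by (intro continuous_on_sum continuous_on_mult continuous_on_prod continuous_on_const that)
  have JG: "continuous_on V (\<lambda>y. J (G y) $ i $ j)" for i j
    by (intro continuous_intros \<open>continuous_on V (\<lambda>y. J (G y))\<close>)
  have "continuous_on V (\<lambda>y. (\<chi> i j. if j = k then (if i = l then 1 else 0) else J (G y) $ i $ j) $ i' $ j')"
    for k l i' j'
    using JG by (cases "j' = k"; cases "i' = l") auto
  note entry = this
  have "continuous_on V (\<lambda>y. \<chi> k l. adjugate (J (G y)) $ k $ l / det (J (G y)))"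
    unfolding adjugate_def vec_lambda_beta
    by (intro continuous_on_vec_lambda continuous_on_divide cont_det ballI nz entry JG)
  then have "continuous_on V (\<lambda>y. matrix_inv (J (G y)))"
    by (rule continuous_on_eq) (simp add: nz matrix_inv_adjugate)
  then have "hol_map_on V G"
    unfolding hol_map_on_def using *(7) g'_eq by (intro exI[of _ "\<lambda>y. matrix_inv (J (G y))"]) auto
  have "U' \<subseteq> U"
    using *(2) by (auto simp: U0_def)
  show ?thesis
    by (rule that[OF *(1) \<open>U' \<subseteq> U\<close> *(3,4) hom(1) \<open>hol_map_on V G\<close> hom(2,3)])
qed

section \<open>Germs of sets\<close>

definition coord_subspace :: "'m set \<Rightarrow> (complex ^ 'm) set" where
  "coord_subspace I = {y. \<forall>k. k \<notin> I \<longrightarrow> y $ k = 0}"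

text \<open>The maps are defined on neighbourhoods in the ambient spaces, but they need to be
  inverse to each other only on \<open>S\<close> and \<open>T\<close>. So \<open>'m\<close> and \<open>'k\<close> may have different sizes.\<close>
definition germ_iso ::
  "(complex ^ 'm) set \<Rightarrow> complex ^ 'm \<Rightarrow> (complex ^ 'k) set \<Rightarrow> complex ^ 'k \<Rightarrow> bool" where
  "germ_iso S p T q \<longleftrightarrow>
     (\<exists>U V F G. open U \<and> open V \<and> p \<in> S \<inter> U \<and> q \<in> T \<inter> V \<and> hol_map_on U F \<and> hol_map_on V G \<and>
        F p = q \<and> (\<forall>x\<in>S \<inter> U. F x \<in> T \<inter> V \<and> G (F x) = x) \<and>
        (\<forall>y\<in>T \<inter> V. G y \<in> S \<inter> U \<and> F (G y) = y))"

lemma germ_isoI: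
  assumes "open U" "open V" "p \<in> S" "p \<in> U" "q \<in> T" "q \<in> V" "hol_map_on U F" "hol_map_on V G" "F p = q"
    "\<And>x. x \<in> S \<Longrightarrow> x \<in> U \<Longrightarrow> F x \<in> T \<and> F x \<in> V \<and> G (F x) = x"
    "\<And>y. y \<in> T \<Longrightarrow> y \<in> V \<Longrightarrow> G y \<in> S \<and> G y \<in> U \<and> F (G y) = y"
  shows "germ_iso S p T q"
  unfolding germ_iso_def using assms
  by (intro exI[of _ U] exI[of _ V] exI[of _ F] exI[of _ G]) auto

lemma germ_isoE:
  assumes "germ_iso S p T q"
  obtains U V F G where "open U" "open V" "p \<in> S" "p \<in> U" "q \<in> T" "q \<in> V"
    "hol_map_on U F" "hol_map_on V G" "F p = q" "G q = p"
    "\<forall>x. x \<in> S \<longrightarrow> x \<in> U \<longrightarrow> F x \<in> T \<and> F x \<in> V \<and> G (F x) = x"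
    "\<forall>y. y \<in> T \<longrightarrow> y \<in> V \<longrightarrow> G y \<in> S \<and> G y \<in> U \<and> F (G y) = y"
proof -
  obtain U V F G where *: "open U" "open V" "p \<in> S \<inter> U" "q \<in> T \<inter> V" "hol_map_on U F" "hol_map_on V G"
        "F p = q" "\<forall>x\<in>S \<inter> U. F x \<in> T \<inter> V \<and> G (F x) = x"
        "\<forall>y\<in>T \<inter> V. G y \<in> S \<inter> U \<and> F (G y) = y"
    using assms unfolding germ_iso_def by (elim exE conjE) 
  show thesis
    by (rule that[of U V F G]) (use * in auto)
qed

lemma germ_iso_sym:
  assumes "germ_iso S p T q"
  shows "germ_iso T q S p"
proof -
  from assms obtain U V F G where *: "open U" "open V" "p \<in> S" "p \<in> U" "q \<in> T" "q \<in> V"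
    "hol_map_on U F" "hol_map_on V G" "F p = q" "G q = p"
    "\<forall>x. x \<in> S \<longrightarrow> x \<in> U \<longrightarrow> F x \<in> T \<and> F x \<in> V \<and> G (F x) = x"
    "\<forall>y. y \<in> T \<longrightarrow> y \<in> V \<longrightarrow> G y \<in> S \<and> G y \<in> U \<and> F (G y) = y"
    by (rule germ_isoE)
  show ?thesis
    by (rule germ_isoI[of V U q T p S G F]) (use * in auto)
qed

lemma open_hol_preimage:
  assumes "hol_map_on U F" "open U" "open V"
  shows "open {x \<in> U. F x \<in> V}"
  using continuous_open_preimage[OF hol_map_on_continuous[OF assms(1)] assms(2,3)]
  by (simp add: Int_def vimage_def)

lemma germ_iso_trans:
  assumes "germ_iso S p T q" "germ_iso T q R r"
  shows "germ_iso S p R r"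
proof -
  from assms(1) obtain U V F G where *: "open U" "open V" "p \<in> S" "p \<in> U" "q \<in> T" "q \<in> V"
    "hol_map_on U F" "hol_map_on V G" "F p = q" "G q = p"
    "\<forall>x. x \<in> S \<longrightarrow> x \<in> U \<longrightarrow> F x \<in> T \<and> F x \<in> V \<and> G (F x) = x"
    "\<forall>y. y \<in> T \<longrightarrow> y \<in> V \<longrightarrow> G y \<in> S \<and> G y \<in> U \<and> F (G y) = y"
    by (rule germ_isoE)
  from assms(2) obtain V' W F' G' where **: "open V'" "open W" "q \<in> T" "q \<in> V'" "r \<in> R" "r \<in> W"
    "hol_map_on V' F'" "hol_map_on W G'" "F' q = r" "G' r = q"
    "\<forall>x. x \<in> T \<longrightarrow> x \<in> V' \<longrightarrow> F' x \<in> R \<and> F' x \<in> W \<and> G' (F' x) = x"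
    "\<forall>y. y \<in> R \<longrightarrow> y \<in> W \<longrightarrow> G' y \<in> T \<and> G' y \<in> V' \<and> F' (G' y) = y"
    by (rule germ_isoE)
  let ?U = "{x \<in> U. F x \<in> V'}" and ?W = "{y \<in> W. G' y \<in> V}"
  have "hol_map_on ?U (\<lambda>x. F' (F x))"
    by (rule hol_map_on_compose[OF **(7) hol_map_on_subset[OF *(7)]]) auto
  moreover have "hol_map_on ?W (\<lambda>x. G (G' x))"
    by (rule hol_map_on_compose[OF *(8) hol_map_on_subset[OF **(8)]]) auto
  ultimately show ?thesis
    by (intro germ_isoI[of ?U ?W p S r R "\<lambda>x. F' (F x)" "\<lambda>x. G (G' x)"] open_hol_preimage)
       (use * ** in auto)
qed

lemma germ_iso_translate:
  assumes "p \<in> coord_subspace I"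
  shows "germ_iso (coord_subspace I) p (coord_subspace I) 0"
  by (rule germ_isoI[of UNIV UNIV _ _ _ _ "\<lambda>x. x - p" "\<lambda>x. x + p"])
     (use assms in \<open>auto simp: coord_subspace_def hol_map_on_iff intro!: hol_fun_on_add hol_fun_on_diff hol_fun_on_coord hol_fun_on_const\<close>)

text \<open>A product of two ambient spaces is again a coordinate space, indexed by the sum of the index
  types.\<close>
definition vec_pair :: "complex ^ 'm \<Rightarrow> complex ^ 'k \<Rightarrow> complex ^ ('m::finite + 'k::finite)" where
  "vec_pair x y = (\<chi> s. case s of Inl i \<Rightarrow> x $ i | Inr j \<Rightarrow> y $ j)"

definition vec_left :: "complex ^ ('m::finite + 'k::finite) \<Rightarrow> complex ^ 'm" where
  "vec_left z = (\<chi> i. z $ Inl i)"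

definition vec_right :: "complex ^ ('m::finite + 'k::finite) \<Rightarrow> complex ^ 'k" where
  "vec_right z = (\<chi> j. z $ Inr j)"

lemma vec_pair_simps [simp]:
  "vec_left (vec_pair x y) = x" "vec_right (vec_pair x y) = y" "vec_pair (vec_left z) (vec_right z) = z"
  by (auto simp: vec_left_def vec_right_def vec_pair_def vec_eq_iff split: sum.split)

lemma hol_map_on_vec_left: "hol_map_on U vec_left"
  by (auto simp: hol_map_on_iff vec_left_def)

lemma hol_map_on_vec_right: "hol_map_on U vec_right"
  by (auto simp: hol_map_on_iff vec_right_def)

lemma hol_map_on_vec_pair:
  assumes "hol_map_on U F" "hol_map_on U G"
  shows "hol_map_on U (\<lambda>x. vec_pair (F x) (G x))"
  unfolding hol_map_on_iff
proof
  fix k show "hol_fun_on U (\<lambda>x. vec_pair (F x) (G x) $ k)"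
    using assms by (cases k) (auto simp: vec_pair_def hol_map_on_iff)
qed

definition germ_prod :: "(complex ^ 'm) set \<Rightarrow> (complex ^ 'k) set \<Rightarrow> (complex ^ ('m + 'k)) set" where
  "germ_prod S T = {z. vec_left z \<in> S \<and> vec_right z \<in> T}"

lemma germ_iso_prod:
  assumes "germ_iso S p T q" "germ_iso S' p' T' q'"
  shows "germ_iso (germ_prod S S') (vec_pair p p') (germ_prod T T') (vec_pair q q')"
proof -
  from assms(1) obtain U V F G where *: "open U" "open V" "p \<in> S" "p \<in> U" "q \<in> T" "q \<in> V"
    "hol_map_on U F" "hol_map_on V G" "F p = q" "G q = p"
    "\<forall>x. x \<in> S \<longrightarrow> x \<in> U \<longrightarrow> F x \<in> T \<and> F x \<in> V \<and> G (F x) = x"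
    "\<forall>y. y \<in> T \<longrightarrow> y \<in> V \<longrightarrow> G y \<in> S \<and> G y \<in> U \<and> F (G y) = y"
    by (rule germ_isoE)
  from assms(2) obtain U' V' F' G' where **: "open U'" "open V'" "p' \<in> S'" "p' \<in> U'" "q' \<in> T'" "q' \<in> V'"
    "hol_map_on U' F'" "hol_map_on V' G'" "F' p' = q'" "G' q' = p'"
    "\<forall>x. x \<in> S' \<longrightarrow> x \<in> U' \<longrightarrow> F' x \<in> T' \<and> F' x \<in> V' \<and> G' (F' x) = x"
    "\<forall>y. y \<in> T' \<longrightarrow> y \<in> V' \<longrightarrow> G' y \<in> S' \<and> G' y \<in> U' \<and> F' (G' y) = y"
    by (rule germ_isoE)
  have open_prod: "open (germ_prod A B)" if "open A" "open B" for A :: "(complex ^ 'x) set" and B :: "(complex ^ 'y) set"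
  proof -
    have "germ_prod A B = {z \<in> {z \<in> UNIV. vec_left z \<in> A}. vec_right z \<in> B}"
      by (auto simp: germ_prod_def)
    then show ?thesis
      using open_hol_preimage[OF hol_map_on_vec_right
          open_hol_preimage[OF hol_map_on_vec_left open_UNIV \<open>open A\<close>] \<open>open B\<close>] by simp
  qed
  have hp: "hol_map_on (germ_prod A B) (\<lambda>z. vec_pair (f (vec_left z)) (g (vec_right z)))"
    if "hol_map_on A f" "hol_map_on B g" for A B f g
    by (intro hol_map_on_vec_pair hol_map_on_compose[OF that(1) hol_map_on_vec_left]
        hol_map_on_compose[OF that(2) hol_map_on_vec_right]) (auto simp: germ_prod_def)
  show ?thesis
    by (rule germ_isoI[OF open_prod[OF *(1) **(1)] open_prod[OF *(2) **(2)] _ _ _ _ hp[OF *(7) **(7)] hp[OF *(8) **(8)]])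
       (use * ** in \<open>auto simp: germ_prod_def\<close>)
qed

lemma germ_prod_coord_subspace:
  "germ_prod (coord_subspace I) (coord_subspace J) = coord_subspace (I <+> J)"
proof -
  have "(\<forall>k. k \<notin> I <+> J \<longrightarrow> z $ k = 0) \<longleftrightarrow> (\<forall>k. k \<notin> I \<longrightarrow> z $ Inl k = 0) \<and> (\<forall>k. k \<notin> J \<longrightarrow> z $ Inr k = 0)"
    for z :: "complex ^ ('a::finite + 'b::finite)"
    by (auto simp: split_sum_all)
  then show ?thesis
    by (auto simp: germ_prod_def coord_subspace_def vec_left_def vec_right_def)
qed

section \<open>Slice charts and dimension\<close>

text \<open>A basis of \<open>W\<close> that is extended to a basis of the whole space gives the columns of \<open>N\<close>.\<close>
lemma subspace_to_coordinates:
  fixes W :: "(complex ^ 'm) set"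
  assumes W: "vec.subspace W"
  obtains N :: "complex ^ 'm ^ 'm" and I :: "'m set" where
    "det N \<noteq> 0" "card I = vec.dim W" "W = (\<lambda>v. N *v v) ` coord_subspace I"
proof -
  obtain B where B: "B \<subseteq> W" "vec.independent B" "W \<subseteq> vec.span B" "card B = vec.dim W"
    using vec.basis_exists by blast
  define B' where "B' = vec.extend_basis B"
  have B': "B \<subseteq> B'" "vec.independent B'" "vec.span B' = UNIV"
    unfolding B'_def using vec.extend_basis_superset[OF B(2)] vec.independent_extend_basis[OF B(2)]
      vec.span_extend_basis[OF B(2)] by auto
  have fin: "finite B'"
    using B'(2) by (rule vec.finiteI_independent)
  have "card B' = CARD('m)"
    using vec.dim_eq_card_independent[OF B'(2)] vec.dim_span[of B'] B'(3)
    by (simp add: card_cart_basis vec.dim_UNIV vec.dimension_def)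
  then obtain f :: "'m \<Rightarrow> complex ^ 'm" where f: "bij_betw f UNIV B'"
    using finite_same_card_bij[OF _ fin, of "UNIV :: 'm set"] by auto
  define N :: "complex ^ 'm ^ 'm" where "N = (\<chi> i k. f k $ i)"
  define I where "I = {k. f k \<in> B}"
  have Nv: "N *v x = (\<Sum>k\<in>UNIV. x $ k *s f k)" for x
    by (simp add: N_def matrix_vector_mult_def vec_eq_iff mult.commute)
  have col: "column k N = f k" for k
    by (simp add: column_def N_def vec_eq_iff)
  have "\<exists>N' :: complex ^ 'm ^ 'm. N' ** N = mat 1"
    unfolding matrix_left_invertible_independent_columns
  proof (intro allI impI)
    fix c i assume *: "(\<Sum>i\<in>UNIV. c i *s column i N) = 0"
    define u where "u b = c (the_inv_into UNIV f b)" for b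
    have injf: "inj f" "range f = B'"
      using f by (auto simp: bij_betw_def)
    have uf: "u (f i) = c i" for i
      unfolding u_def by (simp add: the_inv_into_f_f[OF injf(1)])
    have "(\<Sum>b\<in>B'. u b *s b) = (\<Sum>i\<in>UNIV. c i *s f i)"
      by (subst sum.reindex_bij_betw[OF f, symmetric]) (simp add: uf)
    with * have "(\<Sum>b\<in>B'. u b *s b) = 0"
      by (simp add: col)
    moreover have "f i \<in> B'"
      using injf by auto
    ultimately have "u (f i) = 0"
      using vec.independentD[OF B'(2) fin order_refl] by blast
    then show "c i = 0"
      by (simp add: uf)
  qed
  then have "det N \<noteq> 0"
    by (simp add: invertible_left_inverse flip: invertible_det_nz)
  moreover have fI: "bij_betw f I B"
  proof -
    have "f ` I = B"
      using f B'(1) by (auto simp: I_def bij_betw_def)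
    then show ?thesis
      using f by (metis bij_betw_def inj_on_subset subset_UNIV)
  qed
  then have "card I = vec.dim W"
    using bij_betw_same_card B(4) by metis
  moreover have "W = (\<lambda>v. N *v v) ` coord_subspace I"
  proof -
    have "W = vec.span B"
      using B(1,3) W by (simp add: vec.span_minimal subset_antisym)
    also have "\<dots> = (\<lambda>v. N *v v) ` coord_subspace I"
    proof
      show "vec.span B \<subseteq> (\<lambda>v. N *v v) ` coord_subspace I"
      proof
        fix w assume "w \<in> vec.span B"
        moreover have "finite B"
          using fin B'(1) finite_subset by blast
        ultimately obtain u where w: "w = (\<Sum>b\<in>B. u b *s b)"
          by (auto simp: vec.span_finite)
        have "w = (\<Sum>k\<in>I. u (f k) *s f k)"
          unfolding w by (subst sum.reindex_bij_betw[OF fI, symmetric]) simp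
        also have "\<dots> = N *v (\<chi> k. if k \<in> I then u (f k) else 0)"
          unfolding Nv by (rule sum.mono_neutral_cong_left) auto
        finally show "w \<in> (\<lambda>v. N *v v) ` coord_subspace I"
          by (auto simp: coord_subspace_def)
      qed
      show "(\<lambda>v. N *v v) ` coord_subspace I \<subseteq> vec.span B"
      proof clarify
        fix v :: "complex ^ 'm" assume "v \<in> coord_subspace I"
        then have "v $ k *s f k \<in> vec.span B" for k
          by (cases "k \<in> I") (auto simp: coord_subspace_def I_def vec.span_base vec.span_scale vec.span_zero)
        then show "N *v v \<in> vec.span B"
          unfolding Nv by (intro vec.span_sum) auto
      qed
    qed
    finally show ?thesis .
  qed
  ultimately show thesis
    by (rule that)
qed

lemma hol_map_on_matrix_vector_mult: 
  assumes "hol_map_on U F"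
  shows "hol_map_on U (\<lambda>x. N *v F x)"
  unfolding hol_map_on_iff matrix_vector_mult_def
  by (auto intro!: hol_fun_on_sum hol_fun_on_mult hol_fun_on_const hol_map_onD[OF assms])

lemma hol_map_on_add: "hol_map_on U F \<Longrightarrow> hol_map_on U G \<Longrightarrow> hol_map_on U (\<lambda>x. F x + G x)"
  by (auto simp: hol_map_on_iff)

lemma hol_map_on_diff: "hol_map_on U F \<Longrightarrow> hol_map_on U G \<Longrightarrow> hol_map_on U (\<lambda>x. F x - G x)"
  by (auto simp: hol_map_on_iff)

lemma hol_map_on_const: "hol_map_on U (\<lambda>x. c)"
  by (auto simp: hol_map_on_iff)

lemma hol_map_on_derivative:
  assumes "hol_map_on U F" "p \<in> U"
  obtains A where "(F has_derivative (\<lambda>v. A *v v)) (at p)"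
  using assms unfolding hol_map_on_def by blast

text \<open>The composition \<open>\<rho> = G \<circ> \<pi> \<circ> F\<close>, where \<open>\<pi>\<close> is the projection to the coordinate subspace, is a
  holomorphic retraction onto \<open>S\<close> near \<open>p\<close>. Its derivative \<open>A\<close> at \<open>p\<close> is a projection whose rank is
  \<open>card I\<close>. The map \<open>\<phi> x = A (\<rho> x - p) + (1 - A) (x - \<rho> x)\<close> has derivative \<open>1\<close> at \<open>p\<close>, and it
  straightens \<open>S\<close> to the image of \<open>A\<close>: if \<open>\<phi> x\<close> lies in that image, then
  \<open>\<phi> x = A (\<rho> x - p) = \<phi> (\<rho> x)\<close>, so \<open>x = \<rho> x \<in> S\<close>. A linear automorphism then turns the image of
  \<open>A\<close> into a coordinate subspace.\<close>
lemma slice_chart: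
  fixes S :: "(complex ^ 'm) set" and I :: "'k::finite set"
  assumes "germ_iso S p (coord_subspace I) 0"
  obtains U V \<phi> \<psi> and I' :: "'m set" where
    "open U" "open V" "p \<in> U" "hol_map_on U \<phi>" "hol_map_on V \<psi>" "\<phi> ` U = V"
    "\<forall>x\<in>U. \<psi> (\<phi> x) = x" "card I' = card I" "\<phi> ` (S \<inter> U) = V \<inter> coord_subspace I'"
proof -
  let ?T = "coord_subspace I"
  from assms obtain U V F G where *: "open U" "open V" "p \<in> S" "p \<in> U" "0 \<in> ?T" "0 \<in> V"
    "hol_map_on U F" "hol_map_on V G" "F p = 0" "G 0 = p"
    "\<forall>x. x \<in> S \<longrightarrow> x \<in> U \<longrightarrow> F x \<in> ?T \<and> F x \<in> V \<and> G (F x) = x"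
    "\<forall>y. y \<in> ?T \<longrightarrow> y \<in> V \<longrightarrow> G y \<in> S \<and> G y \<in> U \<and> F (G y) = y"
    by (rule germ_isoE)
  obtain AF where AF: "(F has_derivative (\<lambda>v. AF *v v)) (at p)"
    using hol_map_on_derivative[OF *(7,4)] .
  obtain AG where AG: "(G has_derivative (\<lambda>v. AG *v v)) (at 0)"
    using hol_map_on_derivative[OF *(8,6)] .
  define Pi :: "complex ^ 'k ^ 'k" where "Pi = (\<chi> k l. if k = l \<and> k \<in> I then 1 else 0)"
  have Pi_apply: "Pi *v y = (\<chi> k. if k \<in> I then y $ k else 0)" for y
  proof -
    have "(\<Sum>l\<in>UNIV. (if k = l \<and> k \<in> I then 1 else 0) * y $ l) = (if k \<in> I then y $ k else 0)" for k
    proof -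
      have "(\<Sum>l\<in>UNIV. (if k = l \<and> k \<in> I then 1 else 0) * y $ l) = (\<Sum>l\<in>UNIV. if l = k then (if k \<in> I then y $ k else 0) else 0)"
        by (rule sum.cong) auto
      then show ?thesis by simp
    qed
    then show ?thesis
      by (simp add: Pi_def matrix_vector_mult_def vec_eq_iff)
  qed
  have Pi_T: "Pi *v y \<in> ?T" for y
    by (simp add: Pi_apply coord_subspace_def)
  have Pi_id: "Pi *v y = y" if "y \<in> ?T" for y
    using that by (auto simp: Pi_apply coord_subspace_def vec_eq_iff)
  \<comment> \<open>Differentiate \<open>F (G (t *\<^sub>R v)) = t *\<^sub>R v\<close> with respect to the real variable \<open>t\<close>.\<close>
  have FG: "AF *v (AG *v v) = v" if v: "v \<in> ?T" for v
  proof -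
    have l: "((\<lambda>t::real. t *\<^sub>R v) has_derivative (\<lambda>t. t *\<^sub>R v)) (at 0)"
      by (auto intro!: derivative_eq_intros)
    have "((\<lambda>t::real. G (t *\<^sub>R v)) has_derivative (\<lambda>t. AG *v (t *\<^sub>R v))) (at 0)"
      using diff_chain_at[OF l, of G "\<lambda>v. AG *v v"] AG by (simp add: o_def)
    then have "((\<lambda>t::real. F (G (t *\<^sub>R v))) has_derivative (\<lambda>t. AF *v (AG *v (t *\<^sub>R v)))) (at 0)"
      using diff_chain_at[of "\<lambda>t::real. G (t *\<^sub>R v)" "\<lambda>t. AG *v (t *\<^sub>R v)" 0 F "\<lambda>v. AF *v v"] AF *(10)
      by (simp add: o_def)
    moreover have "open ((\<lambda>t::real. t *\<^sub>R v) -` V)"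
      using *(2) by (intro open_vimage continuous_intros) 
    ultimately have "((\<lambda>t::real. t *\<^sub>R v) has_derivative (\<lambda>t. AF *v (AG *v (t *\<^sub>R v)))) (at 0)"
    proof (rule has_derivative_transform_within_open)
      show "0 \<in> (\<lambda>t::real. t *\<^sub>R v) -` V"
        using *(6) by simp
      show "F (G (t *\<^sub>R v)) = t *\<^sub>R v" if "t \<in> (\<lambda>t::real. t *\<^sub>R v) -` V" for t
        using *(12)[rule_format, of "t *\<^sub>R v"] that v by (auto simp: coord_subspace_def)
    qed
    from has_derivative_unique[OF this l] have "AF *v (AG *v (1 *\<^sub>R v)) = 1 *\<^sub>R v"
      by (rule fun_cong)
    then show ?thesis by simp
  qed
  define A where "A = AG ** Pi ** AF"
  have A_apply: "A *v v = AG *v (Pi *v (AF *v v))" for v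
    by (simp add: A_def matrix_vector_mul_assoc matrix_mul_assoc)
  have AA: "A *v (A *v v) = A *v v" for v
    by (simp add: A_apply FG Pi_T Pi_id)
  have rangeA: "range (\<lambda>v. A *v v) = (\<lambda>v. AG *v v) ` ?T"
  proof
    show "range (\<lambda>v. A *v v) \<subseteq> (\<lambda>v. AG *v v) ` ?T"
      using Pi_T by (auto simp: A_apply)
    have "AG *v v = A *v (AG *v v)" if "v \<in> ?T" for v
      using that by (simp add: A_apply FG Pi_id)
    then show "(\<lambda>v. AG *v v) ` ?T \<subseteq> range (\<lambda>v. A *v v)"
      by (metis image_subsetI rangeI)
  qed
  have subT: "vec.subspace ?T"
    by (auto simp: coord_subspace_def vec.subspace_def)
  have "vec.dim (range (\<lambda>v. A *v v)) = card I"
  proof -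
    have "inj_on (\<lambda>v. AG *v v) (vec.span ?T)"
      using FG by (metis inj_on_inverseI vec.span_eq_iff subT)
    then have "vec.dim ((\<lambda>v. AG *v v) ` ?T) = vec.dim ?T"
      by (intro vec.dim_image_eq matrix_vector_mul_linear_gen)
    then show ?thesis
      using dim_substandard_cart[of I, where 'a = complex] rangeA by (simp add: coord_subspace_def)
  qed
  moreover have "vec.subspace (range (\<lambda>v. A *v v))"
    by (simp add: vec.subspace_image)
  ultimately obtain N :: "complex ^ 'm ^ 'm" and I' :: "'m set" where
    N: "det N \<noteq> 0" "card I' = card I" "range (\<lambda>v. A *v v) = (\<lambda>v. N *v v) ` coord_subspace I'"
    using subspace_to_coordinates by metis
  define U0 where "U0 = {x \<in> U. Pi *v F x \<in> V}"
  define \<rho> where "\<rho> x = G (Pi *v F x)" for x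
  have "open U0"
    unfolding U0_def by (intro open_hol_preimage hol_map_on_matrix_vector_mult *)
  have p0: "p \<in> U0"
    using * by (simp add: U0_def)
  have hol\<rho>: "hol_map_on U0 \<rho>"
    unfolding \<rho>_def
    by (intro hol_map_on_compose[OF *(8)] hol_map_on_matrix_vector_mult hol_map_on_subset[OF *(7)])
       (auto simp: U0_def)
  have \<rho>S: "\<rho> x \<in> S \<and> \<rho> x \<in> U" if "x \<in> U0" for x
    using *(12)[rule_format, of "Pi *v F x"] that Pi_T by (auto simp: U0_def \<rho>_def)
  have \<rho>id: "\<rho> x = x" if "x \<in> S" "x \<in> U" for x
    using *(11)[rule_format, OF that] by (simp add: \<rho>_def Pi_id)
  have \<rho>p: "\<rho> p = p"
    using \<rho>id *(3,4) by blast
  have der\<rho>: "(\<rho> has_derivative (\<lambda>v. A *v v)) (at p)"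
  proof -
    have "((\<lambda>x. Pi *v F x) has_derivative (\<lambda>v. Pi *v (AF *v v))) (at p)"
      by (rule bounded_linear.has_derivative[OF matrix_vector_mul_bounded_linear AF])
    then show ?thesis
      using diff_chain_at[of "\<lambda>x. Pi *v F x" "\<lambda>v. Pi *v (AF *v v)" p G "\<lambda>v. AG *v v"] AG *(9)
      by (simp add: o_def \<rho>_def[abs_def] A_apply)
  qed
  define \<phi>0 where "\<phi>0 x = A *v (\<rho> x - p) + ((x - \<rho> x) - A *v (x - \<rho> x))" for x
  have hol\<phi>0: "hol_map_on U0 \<phi>0"
    unfolding \<phi>0_def
    by (intro hol_map_on_add hol_map_on_diff hol_map_on_matrix_vector_mult hol\<rho> hol_map_on_id hol_map_on_const)
  have der\<phi>0: "(\<phi>0 has_derivative (\<lambda>v. mat 1 *v v)) (at p)"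
  proof -
    note bl = bounded_linear.has_derivative[OF matrix_vector_mul_bounded_linear]
    have "(\<phi>0 has_derivative (\<lambda>v. A *v (A *v v - 0) + ((v - A *v v) - A *v (v - A *v v)))) (at p)"
      unfolding \<phi>0_def[abs_def]
      by (intro has_derivative_add has_derivative_diff bl der\<rho> has_derivative_ident has_derivative_const)
    moreover have "(\<lambda>v. A *v (A *v v - 0) + ((v - A *v v) - A *v (v - A *v v))) = (\<lambda>v. mat 1 *v v)"
      by (rule ext) (simp add: matrix_vector_mult_diff_distrib AA)
    ultimately show ?thesis by (simp only:)
  qed
  obtain U1 V1 \<psi>0 where 1: "open U1" "U1 \<subseteq> U0" "p \<in> U1" "open V1" "\<phi>0 ` U1 = V1" "hol_map_on V1 \<psi>0"
    "\<forall>x\<in>U1. \<psi>0 (\<phi>0 x) = x" "\<forall>y\<in>V1. \<psi>0 y \<in> U1 \<and> \<phi>0 (\<psi>0 y) = y"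
    by (rule hol_map_inverse_function[OF \<open>open U0\<close> p0 hol\<phi>0 der\<phi>0]) auto
  \<comment> \<open>Both \<open>x\<close> and \<open>\<rho> x\<close> have to lie where \<open>\<phi>0\<close> is injective.\<close>
  define U2 where "U2 = {x \<in> U1. \<rho> x \<in> U1}"
  have U2: "open U2" "p \<in> U2"
    unfolding U2_def using 1(1,3) \<rho>p by (auto intro!: open_hol_preimage hol_map_on_subset[OF hol\<rho> 1(2)])
  have key: "x \<in> S \<longleftrightarrow> \<phi>0 x \<in> range (\<lambda>v. A *v v)" if x: "x \<in> U2" for x
  proof
    assume "x \<in> S"
    then have "\<rho> x = x"
      using x \<rho>id 1(2) by (auto simp: U2_def U0_def)
    then show "\<phi>0 x \<in> range (\<lambda>v. A *v v)"
      by (simp add: \<phi>0_def)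
  next
    assume "\<phi>0 x \<in> range (\<lambda>v. A *v v)"
    then have "\<phi>0 x = A *v \<phi>0 x"
      using AA by auto
    also have "\<dots> = A *v (\<rho> x - p)"
    proof -
      have "A *v (A *v a + (w - A *v w)) = A *v a" for a w
        by (simp add: matrix_vector_right_distrib matrix_vector_mult_diff_distrib AA)
      then show ?thesis
        by (simp only: \<phi>0_def)
    qed
    also have "\<dots> = \<phi>0 (\<rho> x)"
    proof -
      have "\<rho> (\<rho> x) = \<rho> x"
        using \<rho>id \<rho>S x 1(2) by (auto simp: U2_def)
      then show ?thesis
        by (simp add: \<phi>0_def)
    qed
    finally have "x = \<rho> x"
      using 1(7) x by (metis (no_types, lifting) U2_def mem_Collect_eq)
    then show "x \<in> S"
      using \<rho>S x 1(2) by (metis (no_types, lifting) U2_def mem_Collect_eq subsetD)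
  qed
  define V2 where "V2 = {y \<in> V1. \<psi>0 y \<in> U2}"
  have "open V2"
    unfolding V2_def by (intro open_hol_preimage 1 U2)
  have N1: "N *v (matrix_inv N *v v) = v" "matrix_inv N *v (N *v v) = v" for v
    by (auto simp: matrix_vector_mul_assoc matrix_inv_left matrix_inv_right N(1))
  define V3 where "V3 = {y \<in> UNIV. N *v y \<in> V2}"
  have V3: "open V3"
    unfolding V3_def
    by (intro open_hol_preimage hol_map_on_matrix_vector_mult hol_map_on_id \<open>open V2\<close> open_UNIV)
  define \<phi> where "\<phi> x = matrix_inv N *v \<phi>0 x" for x
  define \<psi> where "\<psi> y = \<psi>0 (N *v y)" for y
  have img: "\<phi> ` U2 = V3"
  proof
    show "\<phi> ` U2 \<subseteq> V3"
      using 1(5,7) by (auto simp: V3_def V2_def \<phi>_def N1 U2_def)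
    show "V3 \<subseteq> \<phi> ` U2"
    proof
      fix y assume y: "y \<in> V3"
      then have "\<psi>0 (N *v y) \<in> U2" "\<phi>0 (\<psi>0 (N *v y)) = N *v y"
        using 1(8) by (auto simp: V3_def V2_def)
      then have "y = \<phi> (\<psi>0 (N *v y))"
        by (simp add: \<phi>_def N1)
      then show "y \<in> \<phi> ` U2"
        using \<open>\<psi>0 (N *v y) \<in> U2\<close> by blast
    qed
  qed
  have "hol_map_on U2 \<phi>"
    unfolding \<phi>_def using 1(2) by (intro hol_map_on_matrix_vector_mult hol_map_on_subset[OF hol\<phi>0]) (auto simp: U2_def)
  moreover have "hol_map_on V3 \<psi>"
    unfolding \<psi>_def
    by (intro hol_map_on_compose[OF 1(6)] hol_map_on_matrix_vector_mult hol_map_on_id) (auto simp: V3_def V2_def)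
  moreover have "\<psi> (\<phi> x) = x" if "x \<in> U2" for x
    using that 1(7) by (simp add: \<psi>_def \<phi>_def N1 U2_def)
  moreover have "\<phi> ` (S \<inter> U2) = V3 \<inter> coord_subspace I'"
  proof -
    have "x \<in> S \<longleftrightarrow> \<phi> x \<in> coord_subspace I'" if "x \<in> U2" for x
      unfolding key[OF that] N(3) \<phi>_def by (metis (no_types, lifting) N1 image_iff)
    then show ?thesis
      using img by blast
  qed
  ultimately show thesis
    using that[of U2 V3 \<phi> \<psi> I'] U2 V3 img N(2) by blast
qed

text \<open>The coordinate subspace is required to lie in the ambient space of \<open>S\<close>; \<open>manifold_atI\<close> shows
  that a coordinate subspace of any other space does as well.\<close>
definition manifold_at :: "nat \<Rightarrow> (complex ^ 'm) set \<Rightarrow> complex ^ 'm \<Rightarrow> bool" where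
  "manifold_at d S p \<longleftrightarrow> (\<exists>I :: 'm set. card I = d \<and> germ_iso S p (coord_subspace I) 0)"

lemma manifold_atI:
  fixes S :: "(complex ^ 'm) set" and I :: "'k::finite set"
  assumes "germ_iso S p (coord_subspace I) q"
  shows "manifold_at (card I) S p"
proof -
  have "q \<in> coord_subspace I"
    using assms by (auto simp: germ_iso_def)
  then have g: "germ_iso S p (coord_subspace I) 0"
    using germ_iso_trans[OF assms germ_iso_translate] by blast
  then have "p \<in> S"
    by (auto simp: germ_iso_def)
  obtain U V \<phi> \<psi> and I' :: "'m set" where
    *: "open U" "open V" "p \<in> U" "hol_map_on U \<phi>" "hol_map_on V \<psi>" "\<phi> ` U = V"
    "\<forall>x\<in>U. \<psi> (\<phi> x) = x" "card I' = card I" "\<phi> ` (S \<inter> U) = V \<inter> coord_subspace I'"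
    by (rule slice_chart[OF g])
  have "\<phi> p \<in> V \<inter> coord_subspace I'"
    using * \<open>p \<in> S\<close> by blast
  have "germ_iso S p (coord_subspace I') (\<phi> p)"
  proof (rule germ_isoI[OF *(1,2) \<open>p \<in> S\<close> *(3) _ _ *(4,5)])
    fix y assume "y \<in> coord_subspace I'" "y \<in> V"
    then obtain x where "x \<in> S \<inter> U" "y = \<phi> x"
      using *(9) by blast
    then show "\<psi> y \<in> S \<and> \<psi> y \<in> U \<and> \<phi> (\<psi> y) = y"
      using *(7) by simp
  next
    fix x assume "x \<in> S" "x \<in> U"
    then show "\<phi> x \<in> coord_subspace I' \<and> \<phi> x \<in> V \<and> \<psi> (\<phi> x) = x"
      using *(7,9) by blast
  qed (use \<open>\<phi> p \<in> V \<inter> coord_subspace I'\<close> in auto)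
  moreover have "\<phi> p \<in> coord_subspace I'"
    using * \<open>p \<in> S\<close> by auto
  ultimately have "germ_iso S p (coord_subspace I') 0"
    using germ_iso_trans germ_iso_translate by blast
  then show ?thesis
    unfolding manifold_at_def using *(8) by blast
qed

lemma manifold_at_germ_iso:
  assumes "germ_iso S p T q" "manifold_at d T q"
  shows "manifold_at d S p"
  using assms germ_iso_trans manifold_atI unfolding manifold_at_def by blast

lemma manifold_at_prod:
  fixes S :: "(complex ^ 'm) set" and T :: "(complex ^ 'k) set"
  assumes "germ_iso R r (germ_prod S T) (vec_pair p q)" "manifold_at d S p" "manifold_at d' T q"
  shows "manifold_at (d + d') R r"
proof -
  obtain I :: "'m set" and J :: "'k set" where IJ: "card I = d" "germ_iso S p (coord_subspace I) 0" "card J = d'" "germ_iso T q (coord_subspace J) 0"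
    using assms(2,3) unfolding manifold_at_def by blast
  from germ_iso_trans[OF assms(1) germ_iso_prod[OF IJ(2,4)]]
  have "manifold_at (card (I <+> J)) R r"
    unfolding germ_prod_coord_subspace by (rule manifold_atI)
  then show ?thesis
    using IJ by (simp add: card_Plus)
qed

lemma complex_submanifoldI:
  fixes S :: "(complex ^ 'm) set"
  assumes "\<And>p. p \<in> S \<Longrightarrow> manifold_at d S p"
  shows "complex_submanifold d S"
  unfolding complex_submanifold_def
proof
  fix p assume "p \<in> S"
  then obtain I :: "'m set" where I: "card I = d" "germ_iso S p (coord_subspace I) 0"
    using assms unfolding manifold_at_def by blast
  obtain U V \<phi> \<psi> and I' :: "'m set" where
    *: "open U" "open V" "p \<in> U" "hol_map_on U \<phi>" "hol_map_on V \<psi>" "\<phi> ` U = V"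
    "\<forall>x\<in>U. \<psi> (\<phi> x) = x" "card I' = card I" "\<phi> ` (S \<inter> U) = V \<inter> coord_subspace I'"
    by (rule slice_chart[OF I(2)])
  then have "biholomorphic_map U V \<phi>"
    unfolding biholomorphic_map_def using hol_map_on_imp_holomorphic_map_on by blast
  with * I(1) show "\<exists>U V \<phi> I. p \<in> U \<and> biholomorphic_map U V \<phi> \<and> card I = d \<and>
        \<phi> ` (S \<inter> U) = V \<inter> {y. \<forall>k. k \<notin> I \<longrightarrow> y $ k = 0}"
    unfolding coord_subspace_def by (intro exI[of _ U] exI[of _ V] exI[of _ \<phi>] exI[of _ I']) auto
qed

text \<open>The velocities at \<open>p\<close> of curves in \<open>S\<close>. This set does not refer to a chart, so its dimension
  shows that the dimension of a submanifold is unique.\<close>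
definition tangent_vectors :: "(complex ^ 'm) set \<Rightarrow> complex ^ 'm \<Rightarrow> (complex ^ 'm) set" where
  "tangent_vectors S p = {v. \<exists>\<gamma> :: real \<Rightarrow> complex ^ 'm. \<gamma> 0 = p \<and> (\<forall>\<^sub>F t in nhds 0. \<gamma> t \<in> S) \<and>
     (\<gamma> has_derivative (\<lambda>t. t *\<^sub>R v)) (at 0)}"

text \<open>The derivative of the inverse chart maps the coordinate subspace bijectively to the tangent
  vectors: the chart sends curves in \<open>S\<close> to curves in the coordinate subspace, and straight lines there
  come from curves in \<open>S\<close>.\<close>
lemma dim_tangent_vectors:
  fixes S :: "(complex ^ 'm) set"
  assumes "p \<in> S" "p \<in> U" and bi: "biholomorphic_map U V \<phi>"
    and img: "\<phi> ` (S \<inter> U) = V \<inter> coord_subspace I"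
  shows "vec.dim (tangent_vectors S p) = card I"
proof -
  obtain \<psi> where "open U" "open V" "\<phi> ` U = V" "holomorphic_map_on \<phi> U" "holomorphic_map_on \<psi> V"
    and inv: "\<And>x. x \<in> U \<Longrightarrow> \<psi> (\<phi> x) = x"
    using bi unfolding biholomorphic_map_def by blast
  have pV: "\<phi> p \<in> V" "\<phi> p \<in> coord_subspace I"
    using assms by blast+
  obtain L where L: "(\<phi> has_derivative L) (at p)" "Vector_Spaces.linear (*s) (*s) L"
    using \<open>holomorphic_map_on \<phi> U\<close> \<open>p \<in> U\<close> unfolding holomorphic_map_on_def by blast
  obtain K where K: "(\<psi> has_derivative K) (at (\<phi> p))" "Vector_Spaces.linear (*s) (*s) K"
    using \<open>holomorphic_map_on \<psi> V\<close> pV unfolding holomorphic_map_on_def by blast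
  have "((\<lambda>x. \<psi> (\<phi> x)) has_derivative (\<lambda>v. K (L v))) (at p)"
    using diff_chain_at[OF L(1) K(1)] by (simp add: o_def)
  then have "((\<lambda>x. x) has_derivative (\<lambda>v. K (L v))) (at p)"
    by (rule has_derivative_transform_within_open[OF _ \<open>open U\<close> \<open>p \<in> U\<close>]) (rule inv)
  from has_derivative_unique[OF this has_derivative_ident] have KL: "K (L v) = v" for v
    by metis
  have inv': "\<phi> (\<psi> y) = y" if "y \<in> V" for y
    using that \<open>\<phi> ` U = V\<close> inv by auto
  have "(\<phi> has_derivative L) (at (\<psi> (\<phi> p)))"
    using L inv \<open>p \<in> U\<close> by simp
  then have "((\<lambda>x. \<phi> (\<psi> x)) has_derivative (\<lambda>v. L (K v))) (at (\<phi> p))"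
    using diff_chain_at[OF K(1)] by (simp add: o_def)
  then have "((\<lambda>x. x) has_derivative (\<lambda>v. L (K v))) (at (\<phi> p))"
    by (rule has_derivative_transform_within_open[OF _ \<open>open V\<close> pV(1)]) (rule inv')
  from has_derivative_unique[OF this has_derivative_ident] have LK: "L (K v) = v" for v
    by metis
  have "tangent_vectors S p = K ` coord_subspace I"
  proof
    show "tangent_vectors S p \<subseteq> K ` coord_subspace I"
    proof
      fix v assume "v \<in> tangent_vectors S p"
      then obtain \<gamma> :: "real \<Rightarrow> complex ^ 'm" where \<gamma>: "\<gamma> 0 = p" "\<forall>\<^sub>F t in nhds 0. \<gamma> t \<in> S"
        "(\<gamma> has_derivative (\<lambda>t. t *\<^sub>R v)) (at 0)"
        unfolding tangent_vectors_def by blast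
      have "isCont \<gamma> 0"
        using \<gamma>(3) by (rule has_derivative_continuous)
      then have "\<forall>\<^sub>F t in nhds 0. \<gamma> t \<in> U"
        using \<open>open U\<close> \<open>p \<in> U\<close> \<gamma>(1) by (simp add: continuous_at_open eventually_nhds)
      with \<gamma>(2) have "\<forall>\<^sub>F t in nhds 0. \<gamma> t \<in> S \<inter> U"
        by eventually_elim auto
      then obtain W where W: "open W" "0 \<in> W" "\<And>t. t \<in> W \<Longrightarrow> \<gamma> t \<in> S \<inter> U"
        unfolding eventually_nhds by blast
      have "L v \<in> coord_subspace I"
        unfolding coord_subspace_def
      proof (intro CollectI allI impI)
        fix k assume "k \<notin> I"
        have "(\<phi> has_derivative L) (at (\<gamma> 0))"
          using L \<gamma>(1) by simp
        then have "((\<lambda>t. \<phi> (\<gamma> t)) has_derivative (\<lambda>t. L (t *\<^sub>R v))) (at 0)"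
          using diff_chain_at[OF \<gamma>(3)] by (simp add: o_def)
        then have "((\<lambda>t. \<phi> (\<gamma> t) $ k) has_derivative (\<lambda>t. L (t *\<^sub>R v) $ k)) (at 0)"
          by (simp add: has_derivative_vec_componentwise)
        then have "((\<lambda>t. 0) has_derivative (\<lambda>t. L (t *\<^sub>R v) $ k)) (at 0)"
        proof (rule has_derivative_transform_within_open[OF _ W(1,2)])
          fix t assume "t \<in> W"
          then have "\<phi> (\<gamma> t) \<in> coord_subspace I"
            using W(3) img by blast
          then show "\<phi> (\<gamma> t) $ k = 0"
            using \<open>k \<notin> I\<close> by (simp add: coord_subspace_def)
        qed
        from has_derivative_unique[OF this has_derivative_const] have "L (1 *\<^sub>R v) $ k = 0"
          by metis
        then show "L v $ k = 0" by simp
      qed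
      then show "v \<in> K ` coord_subspace I"
        using KL by (metis image_eqI)
    qed
    show "K ` coord_subspace I \<subseteq> tangent_vectors S p"
    proof clarify
      fix w :: "complex ^ 'm" assume w: "w \<in> coord_subspace I"
      define \<gamma> where "\<gamma> t = \<psi> (\<phi> p + t *\<^sub>R w)" for t :: real
      have "((\<lambda>t::real. \<phi> p + t *\<^sub>R w) has_derivative (\<lambda>t. t *\<^sub>R w)) (at 0)"
        by (auto intro!: derivative_eq_intros)
      then have "(\<gamma> has_derivative (\<lambda>t. K (t *\<^sub>R w))) (at 0)"
        using diff_chain_at[of "\<lambda>t::real. \<phi> p + t *\<^sub>R w" "\<lambda>t. t *\<^sub>R w" 0 \<psi> K] K(1)
        by (simp add: o_def \<gamma>_def[abs_def])
      moreover have "K (t *\<^sub>R w) = t *\<^sub>R K w" for t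
        using has_derivative_bounded_linear[OF K(1)] by (simp add: bounded_linear.linear linear_scale)
      moreover have "\<gamma> 0 = p"
        by (simp add: \<gamma>_def inv \<open>p \<in> U\<close>)
      moreover have "\<forall>\<^sub>F t in nhds 0. \<gamma> t \<in> S"
      proof -
        have "open ((\<lambda>t::real. \<phi> p + t *\<^sub>R w) -` V)"
          using \<open>open V\<close> by (intro open_vimage continuous_intros)
        then have "\<forall>\<^sub>F t::real in nhds 0. \<phi> p + t *\<^sub>R w \<in> V"
          using pV(1) by (auto simp: eventually_nhds)
        then show ?thesis
        proof eventually_elim
          case (elim t)
          moreover have "\<phi> p + t *\<^sub>R w \<in> coord_subspace I"
            using w pV(2) by (auto simp: coord_subspace_def)
          ultimately have "\<phi> p + t *\<^sub>R w \<in> \<phi> ` (S \<inter> U)"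
            unfolding img by (rule IntI)
          then obtain x where "x \<in> S \<inter> U" "\<phi> x = \<phi> p + t *\<^sub>R w"
            by (elim imageE) simp
          then show ?case
            using inv[of x] by (simp add: \<gamma>_def)
        qed
      qed
      ultimately show "K w \<in> tangent_vectors S p"
        unfolding tangent_vectors_def by auto
    qed
  qed
  moreover have "vec.dim (K ` coord_subspace I) = vec.dim (coord_subspace I)"
    using K(2) by (intro vec.dim_image_eq) (auto intro!: inj_on_inverseI[of _ L] simp: LK)
  ultimately show ?thesis
    using dim_substandard_cart[of I, where 'a = complex] by (simp add: coord_subspace_def)
qed

lemma manifold_at_dim:
  fixes S :: "(complex ^ 'm) set"
  assumes "manifold_at d S p"
  shows "vec.dim (tangent_vectors S p) = d"
proof -
  obtain I :: "'m set" where I: "card I = d" "germ_iso S p (coord_subspace I) 0"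
    using assms unfolding manifold_at_def by blast
  then have "p \<in> S"
    by (auto simp: germ_iso_def)
  obtain U V \<phi> \<psi> and I' :: "'m set" where
    *: "open U" "open V" "p \<in> U" "hol_map_on U \<phi>" "hol_map_on V \<psi>" "\<phi> ` U = V"
    "\<forall>x\<in>U. \<psi> (\<phi> x) = x" "card I' = card I" "\<phi> ` (S \<inter> U) = V \<inter> coord_subspace I'"
    by (rule slice_chart[OF I(2)])
  then have "biholomorphic_map U V \<phi>"
    unfolding biholomorphic_map_def using hol_map_on_imp_holomorphic_map_on by blast
  from dim_tangent_vectors[OF \<open>p \<in> S\<close> *(3) this *(9)] show ?thesis
    using *(8) I(1) by simp
qed

lemma complex_submanifold_dim_unique:
  fixes S :: "(complex ^ 'm) set"
  assumes "complex_submanifold d S" "complex_submanifold d' S" "p \<in> S"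
  shows "d = d'"
proof -
  have "d = vec.dim (tangent_vectors S p)" if d: "complex_submanifold d S" for d
  proof -
    obtain U V \<phi> and I :: "'m set" where "p \<in> U" "biholomorphic_map U V \<phi>" "card I = d"
        "\<phi> ` (S \<inter> U) = V \<inter> {y. \<forall>k. k \<notin> I \<longrightarrow> y $ k = 0}"
      using bspec[OF d[unfolded complex_submanifold_def] \<open>p \<in> S\<close>] by (elim exE conjE)
    then show ?thesis
      using dim_tangent_vectors[of p S U V \<phi> I] \<open>p \<in> S\<close> by (simp add: coord_subspace_def)
  qed
  from this[OF assms(1)] this[OF assms(2)] show ?thesis by simp
qed

lemma complex_dim_eq:
  assumes "\<And>p. p \<in> S \<Longrightarrow> manifold_at d S p" "S \<noteq> {}"
  shows "complex_dim S = d"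
  unfolding complex_dim_def
proof (rule the_equality)
  show d: "complex_submanifold d S"
    using assms(1) by (rule complex_submanifoldI)
  show "d' = d" if "complex_submanifold d' S" for d'
    using complex_submanifold_dim_unique[OF that d] assms(2) by blast
qed

section \<open>Generic points of algebraic sets\<close>

lemma polynomial_fun_sum: "(\<And>a. a \<in> A \<Longrightarrow> polynomial_fun (f a)) \<Longrightarrow> polynomial_fun (\<lambda>x. \<Sum>a\<in>A. f a x)"
  by (induction A rule: infinite_finite_induct) (auto intro: polynomial_fun.intros)

lemma polynomial_fun_prod: "(\<And>a. a \<in> A \<Longrightarrow> polynomial_fun (f a)) \<Longrightarrow> polynomial_fun (\<lambda>x. \<Prod>a\<in>A. f a x)"
  by (induction A rule: infinite_finite_induct) (auto intro: polynomial_fun.intros)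

lemma polynomial_fun_uminus: "polynomial_fun p \<Longrightarrow> polynomial_fun (\<lambda>x. - p x)"
  using polynomial_fun.mult[OF polynomial_fun.const[of "-1"]] by simp

lemma polynomial_fun_diff: "polynomial_fun p \<Longrightarrow> polynomial_fun q \<Longrightarrow> polynomial_fun (\<lambda>x. p x - q x)"
  using polynomial_fun.add[OF _ polynomial_fun_uminus, of p q] by simp

lemma polynomial_fun_power: "polynomial_fun p \<Longrightarrow> polynomial_fun (\<lambda>x. p x ^ n)"
  by (induction n) (auto intro: polynomial_fun.intros)

lemma polynomial_fun_det:
  fixes A :: "complex ^ 'm \<Rightarrow> complex ^ 'n ^ 'n"
  assumes "\<And>i j. polynomial_fun (\<lambda>x. A x $ i $ j)"
  shows "polynomial_fun (\<lambda>x. det (A x))"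
  unfolding det_def using assms
  by (intro polynomial_fun_sum polynomial_fun.mult polynomial_fun_prod polynomial_fun.const)

definition has_polynomial_gradient :: "(complex ^ 'm \<Rightarrow> complex) \<Rightarrow> ('m \<Rightarrow> complex ^ 'm \<Rightarrow> complex) \<Rightarrow> bool" where
  "has_polynomial_gradient p g \<longleftrightarrow> (\<forall>k. polynomial_fun (g k)) \<and>
     (\<forall>x. (p has_derivative (\<lambda>v. \<Sum>k\<in>UNIV. g k x * v $ k)) (at x))"

text \<open>Only polynomial functions are used as arguments, and for these the choice yields the partial
  derivatives, by \<open>polynomial_gradient_exists\<close>.\<close>
definition gradient :: "(complex ^ 'm \<Rightarrow> complex) \<Rightarrow> 'm \<Rightarrow> complex ^ 'm \<Rightarrow> complex" where
  "gradient p = (SOME g. has_polynomial_gradient p g)"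

lemma polynomial_gradient_exists:
  "polynomial_fun (p :: complex ^ 'm \<Rightarrow> complex) \<Longrightarrow> \<exists>g. has_polynomial_gradient p g"
proof (induction rule: polynomial_fun.induct)
  case (const c)
  show ?case
    by (rule exI[of _ "\<lambda>k x. 0"]) (auto simp: has_polynomial_gradient_def intro: polynomial_fun.intros)
next
  case (coord k)
  have "(\<lambda>v. \<Sum>l\<in>UNIV. (if l = k then 1 else 0) * v $ l) = (\<lambda>v :: complex ^ 'm. v $ k)"
    by (auto simp: if_distrib[where f = "\<lambda>a. a * _"] cong: if_cong)
  then have "((\<lambda>x. x $ k) has_derivative (\<lambda>v. \<Sum>l\<in>UNIV. (if l = k then 1 else 0) * v $ l)) (at x)" for x :: "complex ^ 'm"
    using bounded_linear_imp_has_derivative[OF bounded_linear_vec_nth] by metis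
  then show ?case
    by (intro exI[of _ "\<lambda>l x. if l = k then 1 else 0"]) (auto simp: has_polynomial_gradient_def intro: polynomial_fun.intros)
next
  case (add p q)
  then obtain g h where gh: "has_polynomial_gradient p g" "has_polynomial_gradient q h"
    by blast
  then have "((\<lambda>x. p x + q x) has_derivative (\<lambda>v. \<Sum>k\<in>UNIV. (g k x + h k x) * v $ k)) (at x)" for x
    using has_derivative_add[of p _ "at x" q] unfolding has_polynomial_gradient_def
    by (simp add: sum.distrib distrib_right)
  with gh show ?case
    by (intro exI[of _ "\<lambda>k x. g k x + h k x"]) (auto simp: has_polynomial_gradient_def intro: polynomial_fun.intros)
next
  case (mult p q)
  then obtain g h where gh: "has_polynomial_gradient p g" "has_polynomial_gradient q h"
    by blast
  then have "((\<lambda>x. p x * q x) has_derivative (\<lambda>v. p x * (\<Sum>k\<in>UNIV. h k x * v $ k) + (\<Sum>k\<in>UNIV. g k x * v $ k) * q x)) (at x)" for x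
    using has_derivative_mult[of p _ x UNIV q] unfolding has_polynomial_gradient_def by blast
  then have "((\<lambda>x. p x * q x) has_derivative (\<lambda>v. \<Sum>k\<in>UNIV. (p x * h k x + g k x * q x) * v $ k)) (at x)" for x
    by (simp add: sum.distrib sum_distrib_left sum_distrib_right algebra_simps)
  with gh mult.hyps show ?case
    by (intro exI[of _ "\<lambda>k x. p x * h k x + g k x * q x"]) (auto simp: has_polynomial_gradient_def intro!: polynomial_fun.add polynomial_fun.mult)
qed

lemma gradient:
  assumes "polynomial_fun p"
  shows "polynomial_fun (gradient p k)"
    and "(p has_derivative (\<lambda>v. \<Sum>k\<in>UNIV. gradient p k x * v $ k)) (at x)"
proof -
  have "has_polynomial_gradient p (gradient p)"
    unfolding gradient_def by (rule someI_ex[OF polynomial_gradient_exists[OF assms]])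
  then show "polynomial_fun (gradient p k)"
      "(p has_derivative (\<lambda>v. \<Sum>k\<in>UNIV. gradient p k x * v $ k)) (at x)"
    by (auto simp: has_polynomial_gradient_def)
qed

lemma polynomial_fun_imp_hol_fun_on: "polynomial_fun p \<Longrightarrow> hol_fun_on U p"
  by (induction rule: polynomial_fun.induct) auto

definition jacobian :: "('k \<Rightarrow> complex ^ 'm \<Rightarrow> complex) \<Rightarrow> complex ^ 'm \<Rightarrow> complex ^ 'm ^ 'k" where
  "jacobian R x = (\<chi> k l. gradient (R k) l x)"

lemma has_derivative_jacobian:
  assumes "\<And>k. polynomial_fun (R k)"
  shows "((\<lambda>x. \<chi> k. R k x) has_derivative (\<lambda>v. jacobian R x *v v)) (at x)"
  using gradient(2)[OF assms]
  by (simp add: has_derivative_vec_componentwise jacobian_def matrix_vector_mult_def)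

lemma polynomial_fun_det_jacobian:
  "(\<And>k. polynomial_fun (R k)) \<Longrightarrow> polynomial_fun (\<lambda>x. det (jacobian R x))"
  by (intro polynomial_fun_det) (simp add: jacobian_def gradient)

lemma higher_deriv_sum:
  assumes "open S" "z \<in> S" "\<And>a. a \<in> A \<Longrightarrow> f a holomorphic_on S"
  shows "(deriv ^^ n) (\<lambda>w. \<Sum>a\<in>A. f a w) z = (\<Sum>a\<in>A. (deriv ^^ n) (f a) z)"
  using assms(3)
proof (induction A rule: infinite_finite_induct)
  case (insert a A)
  then have "(deriv ^^ n) (\<lambda>w. f a w + (\<Sum>a\<in>A. f a w)) z
      = (deriv ^^ n) (f a) z + (deriv ^^ n) (\<lambda>w. \<Sum>a\<in>A. f a w) z"
    using assms(1,2) by (intro higher_deriv_add[of _ S] holomorphic_on_sum) auto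
  with insert show ?case by simp
qed auto

text \<open>A uniqueness principle for linear differential equations with infinitely many unknown functions.
  All derivatives at \<open>0\<close> of all members of \<open>\<G>\<close> vanish, by induction on the order: by the Leibniz rule
  the derivative of order \<open>n + 1\<close> of \<open>\<theta>\<close> is a combination of derivatives of order at most \<open>n\<close> of
  other members of \<open>\<G>\<close>.\<close>
lemma linear_system_vanishing:
  fixes \<G> :: "(complex \<Rightarrow> complex) set"
  assumes S: "open S" "connected S" "0 \<in> S"
    and hol: "\<And>\<theta>. \<theta> \<in> \<G> \<Longrightarrow> \<theta> holomorphic_on S" and zero: "\<And>\<theta>. \<theta> \<in> \<G> \<Longrightarrow> \<theta> 0 = 0"
    and deriv: "\<And>\<theta>. \<theta> \<in> \<G> \<Longrightarrow> \<exists>(h :: 'j::finite \<Rightarrow> complex \<Rightarrow> complex) \<eta>. (\<forall>j. h j holomorphic_on S \<and> \<eta> j \<in> \<G>) \<and>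
          (\<forall>t\<in>S. deriv \<theta> t = (\<Sum>j\<in>UNIV. h j t * \<eta> j t))"
    and "\<theta> \<in> \<G>" "t \<in> S"
  shows "\<theta> t = 0"
proof -
  have "(deriv ^^ n) \<theta> 0 = 0" if "\<theta> \<in> \<G>" for n \<theta>
    using that
  proof (induction n arbitrary: \<theta> rule: less_induct)
    case (less n)
    show ?case
    proof (cases n)
      case 0
      then show ?thesis
        using zero less.prems by simp
    next
      case (Suc m)
      obtain h :: "'j \<Rightarrow> complex \<Rightarrow> complex" and \<eta> where h: "\<And>j. h j holomorphic_on S" "\<And>j. \<eta> j \<in> \<G>"
          "\<And>t. t \<in> S \<Longrightarrow> deriv \<theta> t = (\<Sum>j\<in>UNIV. h j t * \<eta> j t)"
        using deriv[OF less.prems] by auto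
      have "(deriv ^^ n) \<theta> 0 = (deriv ^^ m) (deriv \<theta>) 0"
        by (simp only: Suc funpow_Suc_right o_apply)
      also have "\<dots> = (deriv ^^ m) (\<lambda>t. \<Sum>j\<in>UNIV. h j t * \<eta> j t) 0"
      proof (rule higher_deriv_transform_within_open[OF _ _ S(1,3) h(3)])
        show "deriv \<theta> holomorphic_on S"
          using hol[OF less.prems] S(1) by (rule holomorphic_deriv)
        show "(\<lambda>t. \<Sum>j\<in>UNIV. h j t * \<eta> j t) holomorphic_on S"
          by (intro holomorphic_intros h hol)
      qed auto
      also have "\<dots> = (\<Sum>j\<in>UNIV. (deriv ^^ m) (\<lambda>t. h j t * \<eta> j t) 0)"
        using h hol S by (intro higher_deriv_sum[of S]) (auto intro!: holomorphic_on_mult)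
      also have "\<dots> = 0"
      proof (rule sum.neutral, rule ballI)
        fix j
        have "(deriv ^^ m) (\<lambda>t. h j t * \<eta> j t) 0
            = (\<Sum>i = 0..m. of_nat (m choose i) * (deriv ^^ i) (h j) 0 * (deriv ^^ (m - i)) (\<eta> j) 0)"
          using h hol S by (intro higher_deriv_mult) auto
        also have "\<dots> = 0"
          using less.IH[OF _ h(2)] by (intro sum.neutral) (auto simp: Suc)
        finally show "(deriv ^^ m) (\<lambda>t. h j t * \<eta> j t) 0 = 0" .
      qed
      finally show ?thesis .
    qed
  qed
  then show ?thesis
    using holomorphic_fun_eq_0_on_connected[OF hol[OF \<open>\<theta> \<in> \<G>\<close>] S(1,2) _ S(3) \<open>t \<in> S\<close>] \<open>\<theta> \<in> \<G>\<close> by blast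
qed

text \<open>With \<open>w = inv A c\<close> this expresses the linear form \<open>\<gamma>\<close> through the rows of \<open>A\<close>, by Cramer's rule for
  the transposed matrix.\<close>
lemma cramer_rows:
  fixes A :: "complex ^ 'm ^ 'm"
  assumes "det A \<noteq> 0" "A *v w = c"
  shows "(\<Sum>l\<in>UNIV. \<gamma> $ l * w $ l) = (\<Sum>j\<in>UNIV. c $ j / det A * det (\<chi> i. if i = j then \<gamma> else A $ i))"
proof -
  define z where "z = (\<chi> k. det (\<chi> i j. if j = k then \<gamma> $ i else transpose A $ i $ j) / det (transpose A))"
  have dz: "det (\<chi> i j. if j = k then \<gamma> $ i else transpose A $ i $ j) = det (\<chi> i. if i = k then \<gamma> else A $ i)" for k
  proof -
    have "(\<chi> i j. if j = k then \<gamma> $ i else transpose A $ i $ j) = transpose (\<chi> i. if i = k then \<gamma> else A $ i)"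
      by (simp add: transpose_def vec_eq_iff)
    then show ?thesis by (simp add: det_transpose)
  qed
  have "transpose A *v z = \<gamma>"
    using cramer[of "transpose A" z \<gamma>] assms(1) by (simp add: z_def det_transpose)
  then have "(\<Sum>l\<in>UNIV. \<gamma> $ l * w $ l) = (\<Sum>l\<in>UNIV. (\<Sum>k\<in>UNIV. A $ k $ l * z $ k) * w $ l)"
    by (auto simp: matrix_vector_mult_def transpose_def)
  also have "\<dots> = (\<Sum>k\<in>UNIV. z $ k * (\<Sum>l\<in>UNIV. A $ k $ l * w $ l))"
    by (simp add: sum_distrib_left sum_distrib_right mult_ac) (rule sum.swap)
  also have "\<dots> = (\<Sum>k\<in>UNIV. z $ k * c $ k)"
    using assms(2) by (auto simp: matrix_vector_mult_def)
  also have "\<dots> = (\<Sum>j\<in>UNIV. c $ j / det A * det (\<chi> i. if i = j then \<gamma> else A $ i))"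
    unfolding z_def dz by (simp add: det_transpose mult.commute)
  finally show ?thesis .
qed

text \<open>Let \<open>\<I>\<close> be the ideal of \<open>Z\<close>. A system of coordinate functions, some of which are replaced by
  elements of \<open>\<I>\<close>, is a local coordinate system near each point where its Jacobian determinant \<open>q\<close> is
  nonzero. Choose the set \<open>J\<close> of replaced indices as large as possible subject to \<open>q\<close> not vanishing
  identically on \<open>Z\<close>. In these coordinates, \<open>Z\<close> lies in the slice where the coordinates in \<open>J\<close> are zero,
  and the claim is that it fills this slice. By Cramer's rule the derivative of \<open>g \<in> \<I>\<close> along a coordinate
  \<open>j \<notin> J\<close> is \<open>D j g / q\<close>, where \<open>D j g\<close> is the Jacobian determinant after \<open>g\<close> replaces the \<open>j\<close>-th
  function; by the maximality of \<open>J\<close>, the polynomial \<open>D j g\<close> lies in \<open>\<I>\<close> again. So all derivatives of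
  \<open>g\<close> within the slice vanish at a point of \<open>Z\<close>, and \<open>g\<close> is zero on the slice.\<close>
theorem algebraic_set_generically_manifold:
  fixes Z :: "(complex ^ 'm) set"
  assumes Z: "algebraic_set Z" "Z \<noteq> {}"
  shows "\<exists>d q. polynomial_fun q \<and> (\<exists>z\<in>Z. q z \<noteq> 0) \<and> (\<forall>p\<in>Z. q p \<noteq> 0 \<longrightarrow> manifold_at d Z p)"
proof -
  define \<I> where "\<I> = {g. polynomial_fun g \<and> (\<forall>z\<in>Z. g z = 0)}"
  define mix where "mix J f k = (if k \<in> J then f k else (\<lambda>x. x $ k))"
    for J and f :: "'m \<Rightarrow> complex ^ 'm \<Rightarrow> complex" and k
  define good where "good J \<longleftrightarrow> (\<exists>f. (\<forall>k\<in>J. f k \<in> \<I>) \<and> (\<exists>z\<in>Z. det (jacobian (mix J f) z) \<noteq> 0))" for J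
  have "good {}"
  proof -
    have "jacobian (mix {} f) z = mat 1" for f z
    proof -
      have "((\<lambda>x. \<chi> k. mix {} f k x) has_derivative (\<lambda>v. jacobian (mix {} f) z *v v)) (at z)"
        by (rule has_derivative_jacobian) (auto simp: mix_def intro: polynomial_fun.intros)
      then have "((\<lambda>x. x) has_derivative (\<lambda>v. jacobian (mix {} f) z *v v)) (at z)"
        by (simp add: mix_def)
      from has_derivative_unique[OF this has_derivative_ident]
      have "(\<lambda>v. jacobian (mix {} f) z *v v) = (\<lambda>v. mat 1 *v v)"
        by simp
      then show ?thesis
        by (metis matrix_of_matrix_vector_mul)
    qed
    then show ?thesis
      using Z(2) by (auto simp: good_def)
  qed
  moreover have "\<forall>J :: 'm set. good J \<longrightarrow> card J < Suc CARD('m)"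
    by (simp add: card_mono less_Suc_eq_le)
  ultimately obtain J where J: "good J" and Jmax: "\<And>J'. good J' \<Longrightarrow> card J' \<le> card J"
    using Lattices_Big.ex_has_greatest_nat[of good "{}" card "Suc CARD('m)"] by metis
  then obtain f where f: "\<And>k. k \<in> J \<Longrightarrow> f k \<in> \<I>" and f0: "\<exists>z\<in>Z. det (jacobian (mix J f) z) \<noteq> 0"
    unfolding good_def by blast
  define R where "R = mix J f"
  define q where "q x = det (jacobian R x)" for x
  have polyR: "polynomial_fun (R k)" for k
    using f by (auto simp: R_def mix_def \<I>_def intro: polynomial_fun.intros)
  have polyq: "polynomial_fun q"
    unfolding q_def[abs_def] by (intro polynomial_fun_det_jacobian polyR)
  define D where "D j g x = det (jacobian (R(j := g)) x)" for j g x
  have D\<I>: "D j g \<in> \<I>" if "j \<notin> J" "g \<in> \<I>" for j g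
  proof -
    have eq: "mix (insert j J) (f(j := g)) = R(j := g)"
      using that(1) by (auto simp: mix_def R_def fun_eq_iff)
    have "\<not> good (insert j J)"
      using Jmax[of "insert j J"] that(1) by auto
    moreover have "\<forall>k\<in>insert j J. (f(j := g)) k \<in> \<I>"
      using f that by auto
    ultimately have "\<forall>z\<in>Z. det (jacobian (R(j := g)) z) = 0"
      unfolding good_def eq[symmetric] by blast
    moreover have "polynomial_fun (D j g)"
      unfolding D_def[abs_def] using that(2) polyR by (intro polynomial_fun_det_jacobian) (auto simp: \<I>_def)
    ultimately show ?thesis
      by (simp add: \<I>_def D_def)
  qed
  define \<Phi> where "\<Phi> x = (\<chi> k. R k x)" for x
  have hol\<Phi>: "hol_map_on U \<Phi>" for U
    unfolding hol_map_on_iff \<Phi>_def using polyR by (simp add: polynomial_fun_imp_hol_fun_on)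
  have der\<Phi>: "(\<Phi> has_derivative (\<lambda>v. jacobian R x *v v)) (at x)" for x
    unfolding \<Phi>_def[abs_def] using polyR by (rule has_derivative_jacobian)
  have \<Phi>Z: "\<Phi> x \<in> coord_subspace (- J)" if "x \<in> Z" for x
    using f that by (auto simp: coord_subspace_def \<Phi>_def R_def mix_def \<I>_def)
  have "manifold_at (card (- J)) Z p" if p: "p \<in> Z" "q p \<noteq> 0" for p
  proof -
    have "det (jacobian R p) \<noteq> 0"
      using p(2) by (simp add: q_def)
    then obtain U' V \<Psi> where *: "open U'" "U' \<subseteq> UNIV" "p \<in> U'" "open V" "\<Phi> ` U' = V" "hol_map_on V \<Psi>"
      "\<forall>x\<in>U'. \<Psi> (\<Phi> x) = x" "\<forall>y\<in>V. \<Psi> y \<in> U' \<and> \<Phi> (\<Psi> y) = y"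
      by (rule hol_map_inverse_function[OF open_UNIV UNIV_I hol\<Phi> der\<Phi>])
    define y0 where "y0 = \<Phi> p"
    have "y0 \<in> V"
      using * by (auto simp: y0_def)
    then obtain r where r: "r > 0" "ball y0 r \<subseteq> V"
      using \<open>open V\<close> open_contains_ball by blast
    have slice: "\<Psi> y \<in> Z" if y: "y \<in> coord_subspace (- J)" "y \<in> ball y0 r" for y
    proof -
      define c where "c = y - y0"
      have c0: "c $ k = 0" if "k \<in> J" for k
        using y(1) \<Phi>Z[OF p(1)] that by (auto simp: c_def y0_def coord_subspace_def)
      \<comment> \<open>Join \<open>y0\<close> to \<open>y\<close> by a complex line, in order to use one complex variable only.\<close>
      define line where "line t = y0 + t *s c" for t
      have cont_line: "continuous_on A line" for A
        unfolding line_def vector_scalar_mult_def by (intro continuous_intros)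
      define S where "S = line -` ball y0 r"
      have "open S"
        unfolding S_def by (intro open_vimage cont_line open_ball)
      have "convex S"
        unfolding convex_def
      proof (intro ballI allI impI)
        fix s t and u v :: real assume st: "s \<in> S" "t \<in> S" "0 \<le> u" "0 \<le> v" "u + v = 1"
        have "line (u *\<^sub>R s + v *\<^sub>R t) = (u + v) *\<^sub>R y0 + (u *\<^sub>R s + v *\<^sub>R t) *s c"
          using st by (simp add: line_def)
        also have "\<dots> = u *\<^sub>R line s + v *\<^sub>R line t"
          by (simp add: line_def vec_eq_iff algebra_simps)
        finally show "u *\<^sub>R s + v *\<^sub>R t \<in> S"
          using st convexD[OF convex_ball[of y0 r], of "line s" "line t" u v] by (simp add: S_def)
      qed
      have S01: "0 \<in> S" "1 \<in> S"
        using y(2) r(1) by (auto simp: S_def line_def c_def)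
      have lineV: "line t \<in> V" if "t \<in> S" for t
        using that r(2) by (auto simp: S_def)
      define \<theta> where "\<theta> g t = g (\<Psi> (line t))" for g :: "complex ^ 'm \<Rightarrow> complex" and t
      have der: "q (\<Psi> (line t)) \<noteq> 0 \<and> (\<theta> g has_field_derivative
            (\<Sum>j\<in>UNIV. c $ j / q (\<Psi> (line t)) * D j g (\<Psi> (line t)))) (at t)"
        if t: "t \<in> S" and g: "polynomial_fun g" for g t
      proof -
        let ?x = "\<Psi> (line t)"
        obtain B where B: "(\<Psi> has_derivative (\<lambda>v. B *v v)) (at (line t))"
          using hol_map_on_derivative[OF *(6) lineV[OF t]] .
        have "((\<lambda>y. \<Phi> (\<Psi> y)) has_derivative (\<lambda>v. jacobian R ?x *v (B *v v))) (at (line t))"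
          using diff_chain_at[OF B der\<Phi>] by (simp add: o_def)
        then have "((\<lambda>y. y) has_derivative (\<lambda>v. jacobian R ?x *v (B *v v))) (at (line t))"
          by (rule has_derivative_transform_within_open[OF _ \<open>open V\<close> lineV[OF t]]) (use *(8) in blast)
        from has_derivative_unique[OF this has_derivative_ident] have JB: "jacobian R ?x *v (B *v v) = v" for v
          by metis
        then have "jacobian R ?x ** B = mat 1"
          by (simp add: matrix_eq matrix_vector_mul_assoc)
        then have qx: "det (jacobian R ?x) \<noteq> 0"
          unfolding invertible_det_nz[symmetric] invertible_right_inverse by blast
        have "(line has_derivative (\<lambda>s. s *s c)) (at t)"
          unfolding has_derivative_vec_componentwise
          by (auto simp: line_def intro!: derivative_eq_intros)
        then have "((\<lambda>t. \<Psi> (line t)) has_derivative (\<lambda>s. B *v (s *s c))) (at t)"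
          using diff_chain_at[of line "\<lambda>s. s *s c" t \<Psi>] B by (simp add: o_def)
        then have "(\<theta> g has_derivative (\<lambda>s. \<Sum>l\<in>UNIV. gradient g l ?x * (B *v (s *s c)) $ l)) (at t)"
          using diff_chain_at[of "\<lambda>t. \<Psi> (line t)" "\<lambda>s. B *v (s *s c)" t g, OF _ gradient(2)[OF g]] by (simp add: o_def \<theta>_def[abs_def])
        moreover have "(\<Sum>l\<in>UNIV. gradient g l ?x * (B *v (s *s c)) $ l)
            = (\<Sum>l\<in>UNIV. (\<chi> l. gradient g l ?x) $ l * (B *v c) $ l) * s" for s
          by (simp add: vec.scale sum_distrib_left mult_ac)
        ultimately have "(\<theta> g has_field_derivative (\<Sum>l\<in>UNIV. (\<chi> l. gradient g l ?x) $ l * (B *v c) $ l)) (at t)"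
          by (simp add: has_field_derivative_def)
        also have "(\<Sum>l\<in>UNIV. (\<chi> l. gradient g l ?x) $ l * (B *v c) $ l)
            = (\<Sum>j\<in>UNIV. c $ j / det (jacobian R ?x) * det (\<chi> i. if i = j then (\<chi> l. gradient g l ?x) else jacobian R ?x $ i))"
          using qx JB by (rule cramer_rows)
        also have "\<dots> = (\<Sum>j\<in>UNIV. c $ j / q ?x * D j g ?x)"
        proof (rule sum.cong[OF refl])
          fix j
          have "(\<chi> i. if i = j then (\<chi> l. gradient g l ?x) else jacobian R ?x $ i) = jacobian (R(j := g)) ?x"
            by (simp add: jacobian_def vec_eq_iff)
          then show "c $ j / det (jacobian R ?x) * det (\<chi> i. if i = j then (\<chi> l. gradient g l ?x) else jacobian R ?x $ i)
              = c $ j / q ?x * D j g ?x"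
            by (simp add: q_def D_def)
        qed
        finally show ?thesis
          using qx by (simp add: q_def)
      qed
      have hol\<theta>: "\<theta> g holomorphic_on S" if "polynomial_fun g" for g
        unfolding holomorphic_on_open[OF \<open>open S\<close>] using der[OF _ that] by blast
      have van: "\<theta> g 1 = 0" if g: "g \<in> \<I>" for g
      proof (rule linear_system_vanishing[of S "\<theta> ` \<I>" "\<theta> g" 1, where 'j = 'm])
        show "open S" "connected S" "0 \<in> S" "1 \<in> S" "\<theta> g \<in> \<theta> ` \<I>"
          using \<open>open S\<close> \<open>convex S\<close> S01 g by (auto intro: convex_connected)
        show "\<eta> holomorphic_on S" if "\<eta> \<in> \<theta> ` \<I>" for \<eta>
          using that hol\<theta> by (auto simp: \<I>_def)
        show "\<eta> 0 = 0" if "\<eta> \<in> \<theta> ` \<I>" for \<eta>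
          using that p(1) *(3,7) by (auto simp: \<I>_def \<theta>_def line_def y0_def)
        fix \<eta> assume "\<eta> \<in> \<theta> ` \<I>"
        then obtain g' where g': "g' \<in> \<I>" "\<eta> = \<theta> g'" by blast
        \<comment> \<open>For \<open>j \<in> J\<close> the polynomial \<open>D j g'\<close> may lie outside \<open>\<I>\<close>, but its coefficient \<open>c $ j\<close> is zero.\<close>
        define h where "h j t = (if j \<in> J then 0 else c $ j / \<theta> q t)" for j t
        define \<kappa> where "\<kappa> j = \<theta> (if j \<in> J then g' else D j g')" for j
        have "\<theta> q t \<noteq> 0" if "t \<in> S" for t
          using der[OF that polyq] by (simp add: \<theta>_def)
        then have "h j holomorphic_on S" for j
          using hol\<theta>[OF polyq] by (cases "j \<in> J") (auto simp: h_def[abs_def] intro!: holomorphic_intros)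
        moreover have "\<kappa> j \<in> \<theta> ` \<I>" for j
          using g' D\<I> by (auto simp: \<kappa>_def)
        moreover have "deriv \<eta> t = (\<Sum>j\<in>UNIV. h j t * \<kappa> j t)" if "t \<in> S" for t
        proof -
          have "deriv \<eta> t = (\<Sum>j\<in>UNIV. c $ j / q (\<Psi> (line t)) * D j g' (\<Psi> (line t)))"
            unfolding g'(2) using der[OF that] g'(1) by (intro DERIV_imp_deriv) (auto simp: \<I>_def)
          also have "\<dots> = (\<Sum>j\<in>UNIV. h j t * \<kappa> j t)"
            by (rule sum.cong) (auto simp: h_def \<kappa>_def c0 \<theta>_def)
          finally show ?thesis .
        qed
        ultimately show "\<exists>(h :: 'm \<Rightarrow> complex \<Rightarrow> complex) \<kappa>. (\<forall>j. h j holomorphic_on S \<and> \<kappa> j \<in> \<theta> ` \<I>) \<and>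
            (\<forall>t\<in>S. deriv \<eta> t = (\<Sum>j\<in>UNIV. h j t * \<kappa> j t))"
          by (intro exI[of _ h] exI[of _ \<kappa>]) auto
      qed
      have "g (\<Psi> y) = 0" if "g \<in> \<I>" for g
        using van[OF that] by (simp add: \<theta>_def line_def c_def)
      moreover obtain P where P: "\<forall>g\<in>P. polynomial_fun g" "Z = {x. \<forall>g\<in>P. g x = 0}"
        using Z(1) unfolding algebraic_set_def by blast
      moreover from P have "P \<subseteq> \<I>"
        by (auto simp: \<I>_def)
      ultimately show ?thesis
        by blast
    qed
    show ?thesis
    proof (rule manifold_atI, rule germ_isoI[of "{x \<in> U'. \<Phi> x \<in> ball y0 r}" "ball y0 r" _ _ y0 _ \<Phi> \<Psi>])
      show "open {x \<in> U'. \<Phi> x \<in> ball y0 r}"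
        using hol\<Phi> \<open>open U'\<close> by (intro open_hol_preimage) auto
      show "hol_map_on (ball y0 r) \<Psi>"
        using *(6) r(2) by (rule hol_map_on_subset)
    qed (use * r p hol\<Phi> \<Phi>Z slice in \<open>auto simp: y0_def\<close>)
  qed
  moreover have "\<exists>z\<in>Z. q z \<noteq> 0"
    using f0 by (simp add: q_def R_def)
  ultimately show ?thesis
    using polyq by blast
qed

section \<open>Inverses in corners of matrix monoids\<close>

lemma matrix_add_rdistrib_complex: "(A + B) ** C = A ** C + B ** (C :: complex ^ 'n ^ 'n)"
  by (simp add: matrix_matrix_mult_def vec_eq_iff sum.distrib algebra_simps)

lemma matrix_diff_rdistrib: "(A - B) ** C = A ** C - B ** (C :: complex ^ 'n ^ 'n)"
  by (simp add: matrix_matrix_mult_def vec_eq_iff sum_subtractf algebra_simps)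

lemma matrix_diff_ldistrib: "C ** (A - B) = C ** A - C ** (B :: complex ^ 'n ^ 'n)"
  by (simp add: matrix_matrix_mult_def vec_eq_iff sum_subtractf algebra_simps)

lemmas matrix_distribs = matrix_add_ldistrib matrix_add_rdistrib_complex matrix_diff_rdistrib matrix_diff_ldistrib

lemmas mult_right_assoc = matrix_mul_assoc[symmetric]

text \<open>Products are normalised by right association. An equation for a product of two or three
  factors then also has to rewrite longer products that begin with these factors.\<close>
lemma absorb2: "a ** b = c \<Longrightarrow> a ** (b ** z) = c ** (z :: complex ^ 'n ^ 'n)"
  by (simp add: matrix_mul_assoc)

lemma absorb3: "a ** (b ** c) = d \<Longrightarrow> a ** (b ** (c ** z)) = d ** (z :: complex ^ 'n ^ 'n)"
  by (simp add: matrix_mul_assoc)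

lemma matrix_inverse_pair:
  fixes a :: "complex ^ 'n ^ 'n"
  assumes "a ** b = mat 1"
  shows "det a \<noteq> 0" "matrix_inv a = b"
proof -
  show "det a \<noteq> 0"
    using assms unfolding invertible_det_nz[symmetric] invertible_right_inverse by blast
  then have "matrix_inv a ** (a ** b) = b"
    by (simp add: matrix_mul_assoc matrix_inv_left)
  then show "matrix_inv a = b"
    by (simp add: assms)
qed

text \<open>For an idempotent \<open>f\<close>, the matrix \<open>f ** x ** f\<close> is invertible in the corner ring with identity
  \<open>f\<close> if and only if adding the complementary idempotent makes it an invertible matrix. This form
  shows that the condition is open and the inverse \<open>corner_inv f x\<close> holomorphic in \<open>x\<close>.\<close>
definition corner_unit :: "complex ^ 'n ^ 'n \<Rightarrow> complex ^ 'n ^ 'n \<Rightarrow> bool" where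
  "corner_unit f x \<longleftrightarrow> det (f ** x ** f + (mat 1 - f)) \<noteq> 0"

definition corner_inv :: "complex ^ 'n ^ 'n \<Rightarrow> complex ^ 'n ^ 'n \<Rightarrow> complex ^ 'n ^ 'n" where
  "corner_inv f x = f ** matrix_inv (f ** x ** f + (mat 1 - f))"

lemma corner_inv:
  assumes f: "f ** f = f" and unit: "corner_unit f x"
  shows "f ** corner_inv f x = corner_inv f x" "corner_inv f x ** f = corner_inv f x"
    "corner_inv f x ** (x ** f) = f" "f ** (x ** corner_inv f x) = f"
proof -
  define A where "A = f ** x ** f + (mat 1 - f)"
  define w where "w = matrix_inv A"
  have Aw: "A ** w = mat 1" and wA: "w ** A = mat 1"
    using unit by (auto simp: corner_unit_def A_def w_def matrix_inv_left matrix_inv_right)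
  have u: "corner_inv f x = f ** w"
    by (simp add: corner_inv_def w_def A_def)
  have fA: "f ** A = f ** (x ** f)" and Af: "A ** f = f ** (x ** f)"
    by (simp_all add: A_def matrix_distribs mult_right_assoc f absorb2[OF f])
  have wf: "w ** f = f ** w"
  proof -
    have "w ** f = w ** (f ** (A ** w))"
      by (simp add: Aw)
    also have "\<dots> = w ** ((f ** A) ** w)"
      by (simp add: mult_right_assoc)
    also have "\<dots> = (w ** A) ** (f ** w)"
      unfolding fA Af[symmetric] by (simp only: mult_right_assoc)
    finally show ?thesis by (simp add: wA)
  qed
  show "f ** corner_inv f x = corner_inv f x"
    by (simp add: u absorb2[OF f])
  show "corner_inv f x ** f = corner_inv f x"
    by (simp add: u mult_right_assoc wf absorb2[OF f])
  have "corner_inv f x ** (x ** f) = w ** (f ** (x ** f))"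
    by (simp add: u wf[symmetric] mult_right_assoc)
  also have "\<dots> = f"
    unfolding Af[symmetric] by (simp add: matrix_mul_assoc wA)
  finally show "corner_inv f x ** (x ** f) = f" .
  have "f ** (x ** corner_inv f x) = (f ** (x ** f)) ** w"
    by (simp add: u mult_right_assoc)
  also have "\<dots> = f"
    unfolding fA[symmetric] by (simp add: mult_right_assoc Aw)
  finally show "f ** (x ** corner_inv f x) = f" .
qed

lemma corner_invI:
  assumes "f ** f = f" "f ** u = u" "u ** f = u" "f ** (x ** u) = f"
  shows "corner_unit f x" "corner_inv f x = u"
proof -
  have "(f ** x ** f + (mat 1 - f)) ** (u + (mat 1 - f)) = mat 1"
    by (simp add: matrix_distribs mult_right_assoc assms absorb2[OF assms(1)] absorb2[OF assms(2)])
  note inv = matrix_inverse_pair[OF this]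
  show "corner_unit f x"
    using inv(1) by (simp add: corner_unit_def)
  show "corner_inv f x = u"
    by (simp add: corner_inv_def inv(2) matrix_distribs assms)
qed

section \<open>Matrices as points of affine space\<close>

definition unentries :: "complex ^ ('n::finite \<times> 'n) \<Rightarrow> complex ^ 'n ^ 'n" where
  "unentries x = (\<chi> i j. x $ (i, j))"

lemma unentries_entries [simp]: "unentries (entries A) = A"
  by (simp add: unentries_def entries_def vec_eq_iff)

lemma entries_unentries [simp]: "entries (unentries x) = x"
  by (simp add: unentries_def entries_def vec_eq_iff)

lemma in_entries_image_iff: "x \<in> entries ` S \<longleftrightarrow> unentries x \<in> S"
  by (metis entries_unentries image_iff unentries_entries)

definition hol_matrix_on :: "(complex ^ 'm) set \<Rightarrow> (complex ^ 'm \<Rightarrow> complex ^ 'n ^ 'n) \<Rightarrow> bool" where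
  "hol_matrix_on U A \<longleftrightarrow> (\<forall>i j. hol_fun_on U (\<lambda>x. A x $ i $ j))"

lemma hol_matrix_on_const: "hol_matrix_on U (\<lambda>x. C)"
  by (auto simp: hol_matrix_on_def)

lemma hol_matrix_on_mult: "hol_matrix_on U A \<Longrightarrow> hol_matrix_on U B \<Longrightarrow> hol_matrix_on U (\<lambda>x. A x ** B x)"
  unfolding hol_matrix_on_def matrix_matrix_mult_def
  by (auto intro!: hol_fun_on_sum hol_fun_on_mult)

lemma hol_matrix_on_add: "hol_matrix_on U A \<Longrightarrow> hol_matrix_on U B \<Longrightarrow> hol_matrix_on U (\<lambda>x. A x + B x)"
  by (auto simp: hol_matrix_on_def)

lemma hol_matrix_on_diff: "hol_matrix_on U A \<Longrightarrow> hol_matrix_on U B \<Longrightarrow> hol_matrix_on U (\<lambda>x. A x - B x)"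
  by (auto simp: hol_matrix_on_def)

lemma hol_matrix_on_unentries: "hol_map_on U F \<Longrightarrow> hol_matrix_on U (\<lambda>x. unentries (F x))"
  by (auto simp: hol_matrix_on_def unentries_def hol_map_on_iff)

lemma hol_matrix_on_subset: "hol_matrix_on U A \<Longrightarrow> W \<subseteq> U \<Longrightarrow> hol_matrix_on W A"
  unfolding hol_matrix_on_def using hol_fun_on_subset by blast

lemma hol_map_on_entries: "hol_matrix_on U A \<Longrightarrow> hol_map_on U (\<lambda>x. entries (A x))"
  by (auto simp: hol_matrix_on_def entries_def hol_map_on_iff)

lemma open_hol_nonzero: "hol_fun_on U h \<Longrightarrow> open U \<Longrightarrow> open {x \<in> U. h x \<noteq> 0}"
  using continuous_open_preimage[OF hol_fun_on_continuous, of U h "- {0}"]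
  by (simp add: Int_def vimage_def open_Compl)

lemma corner_hol:
  assumes "hol_matrix_on U A" "open U"
  shows "open {x \<in> U. corner_unit f (A x)}"
    and "hol_matrix_on {x \<in> U. corner_unit f (A x)} (\<lambda>x. corner_inv f (A x))"
proof -
  let ?B = "\<lambda>x. f ** A x ** f + (mat 1 - f)"
  have B: "hol_matrix_on U ?B"
    by (intro hol_matrix_on_add hol_matrix_on_mult hol_matrix_on_const assms)
  then have "hol_fun_on U (\<lambda>x. det (?B x))"
    by (intro hol_fun_on_det) (auto simp: hol_matrix_on_def)
  from open_hol_nonzero[OF this \<open>open U\<close>] show o: "open {x \<in> U. corner_unit f (A x)}"
    by (simp add: corner_unit_def)
  have "hol_matrix_on {x \<in> U. corner_unit f (A x)} ?B"
    using B by (rule hol_matrix_on_subset) auto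
  then have "hol_matrix_on {x \<in> U. corner_unit f (A x)} (\<lambda>x. matrix_inv (?B x))"
    using o unfolding hol_matrix_on_def
    by (intro allI hol_fun_on_matrix_inv) (auto simp: corner_unit_def)
  then show "hol_matrix_on {x \<in> U. corner_unit f (A x)} (\<lambda>x. corner_inv f (A x))"
    unfolding corner_inv_def by (intro hol_matrix_on_mult hol_matrix_on_const)
qed

lemma germ_iso_entriesI:
  assumes "open {x. P (unentries x)}" "hol_matrix_on {x. P (unentries x)} (\<lambda>x. F (unentries x))"
    and "open {x. Q (unentries x)}" "hol_matrix_on {x. Q (unentries x)} (\<lambda>x. G (unentries x))"
    and "p \<in> S" "P p" "F p = q"
    and FG: "\<And>x. x \<in> S \<Longrightarrow> P x \<Longrightarrow> F x \<in> T \<and> Q (F x) \<and> G (F x) = x"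
    and GF: "\<And>y. y \<in> T \<Longrightarrow> Q y \<Longrightarrow> G y \<in> S \<and> P (G y) \<and> F (G y) = y"
  shows "germ_iso (entries ` S) (entries p) (entries ` T) (entries q)"
  by (rule germ_isoI[OF assms(1,3) _ _ _ _ hol_map_on_entries[OF assms(2)] hol_map_on_entries[OF assms(4)]])
     (use assms(5-) in \<open>auto simp: in_entries_image_iff\<close>)

section \<open>Regular monoids of matrices\<close>

locale regular_monoid =
  fixes M :: "(complex ^ 'n ^ 'n) set"
  assumes one: "mat 1 \<in> M" and mult: "\<And>a b. a \<in> M \<Longrightarrow> b \<in> M \<Longrightarrow> a ** b \<in> M"
    and regular: "\<And>a. a \<in> M \<Longrightarrow> \<exists>x\<in>M. a ** (x ** a) = a"
begin

text \<open>If \<open>a = f ** x ** f\<close> and \<open>a ** y ** a = a\<close> with \<open>y \<in> M\<close>, then cancelling \<open>a\<close> on both sides gives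
  the corner inverse as \<open>f ** y ** f\<close>.\<close>
lemma corner_inv_mem:
  assumes f: "f \<in> M" "f ** f = f" and x: "x \<in> M" "corner_unit f x"
  shows "corner_inv f x \<in> M"
proof -
  let ?u = "corner_inv f x"
  note u = corner_inv[OF f(2) x(2)]
  define a where "a = f ** (x ** f)"
  have "a \<in> M"
    unfolding a_def by (intro mult f x)
  then obtain y where y: "y \<in> M" "a ** (y ** a) = a"
    using regular by blast
  have ua: "?u ** a = f" and au: "a ** ?u = f"
    by (simp_all add: a_def mult_right_assoc u absorb2[OF u(2)])
  have "?u = ?u ** (a ** ?u)"
    by (simp add: au u)
  also have "\<dots> = ?u ** (a ** (y ** (a ** ?u)))"
    by (simp add: absorb3[OF y(2)])
  also have "\<dots> = f ** (y ** f)"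
    by (simp add: au absorb2[OF ua])
  finally show ?thesis
    using mult f(1) y(1) by simp
qed

lemma unit_inverse_mem:
  assumes "a \<in> M" "det a \<noteq> 0"
  obtains b where "b \<in> M" "a ** b = mat 1" "b ** a = mat 1"
proof -
  obtain b where b: "b \<in> M" "a ** (b ** a) = a"
    using regular assms(1) by blast
  have "matrix_inv a ** (a ** (b ** a)) = mat 1"
    unfolding b by (rule matrix_inv_left[OF assms(2)])
  then have "b ** a = mat 1"
    by (simp add: absorb2[OF matrix_inv_left[OF assms(2)]])
  with b(1) that show thesis
    using matrix_left_right_inverse by blast
qed

end

text \<open>For an idempotent \<open>f \<in> M\<close> these are the idempotents of the \<open>\<L>\<close>-class of \<open>f\<close>, namely those
  with the kernel of \<open>f\<close>; see \<open>idempotents_L_class\<close>.\<close>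
definition left_idempotents :: "(complex ^ 'n ^ 'n) set \<Rightarrow> complex ^ 'n ^ 'n \<Rightarrow> (complex ^ 'n ^ 'n) set" where
  "left_idempotents M f = {k \<in> M. f ** k = f \<and> k ** f = k}"

definition right_idempotents :: "(complex ^ 'n ^ 'n) set \<Rightarrow> complex ^ 'n ^ 'n \<Rightarrow> (complex ^ 'n ^ 'n) set" where
  "right_idempotents M f = {h \<in> M. f ** h = h \<and> h ** f = f}"

lemma left_idempotents_eq:
  assumes "f ** g = f" "g ** f = g"
  shows "left_idempotents M f = left_idempotents M g"
proof -
  have "g ** k = g \<longleftrightarrow> f ** k = f" for k
    by (metis assms matrix_mul_assoc)
  moreover have "k ** f = k \<longleftrightarrow> k ** g = k" for k
    by (metis assms matrix_mul_assoc)
  ultimately show ?thesis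
    by (auto simp: left_idempotents_def)
qed

context regular_monoid
begin

text \<open>The idempotents \<open>f\<close> and \<open>g\<close> have the same image. For \<open>k\<close> in the \<open>\<L>\<close>-class of \<open>f\<close> near \<open>f\<close>, the image
  of \<open>k\<close> is still a complement of the kernel of \<open>g\<close>. So there is an idempotent with the image of \<open>k\<close>
  and the kernel of \<open>g\<close>, and it is \<open>k ** (corner_inv f (g ** k) ** g)\<close>. Exchanging \<open>f\<close> and \<open>g\<close> gives the
  inverse map.\<close>
lemma germ_iso_right_related:
  assumes f: "f \<in> M" "f ** f = f" and g: "g \<in> M" "g ** g = g" and fg: "f ** g = g" "g ** f = f"
  shows "germ_iso (entries ` left_idempotents M f) (entries f) (entries ` left_idempotents M g) (entries g)"
proof -
  define move where "move f g k = k ** (corner_inv f (g ** k) ** g)" for f g k :: "complex ^ 'n ^ 'n"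
  have move: "move f g k \<in> left_idempotents M g \<and> corner_unit g (f ** move f g k) \<and> move g f (move f g k) = k"
    if f: "f \<in> M" "f ** f = f" and g: "g \<in> M" "g ** g = g" and fg: "f ** g = g" "g ** f = f"
      and k: "k \<in> left_idempotents M f" "corner_unit f (g ** k)" for f g k
  proof -
    define u where "u = corner_inv f (g ** k)"
    have k': "k \<in> M" "f ** k = f" "k ** f = k"
      using k(1) by (auto simp: left_idempotents_def)
    have "u \<in> M"
      unfolding u_def by (intro corner_inv_mem f mult g k' k)
    note u = corner_inv[OF f(2) k(2), folded u_def, unfolded mult_right_assoc]
    have ugk: "u ** (g ** k) = f"
      using u(3) by (simp add: k')
    have gku: "g ** (k ** u) = f"
      using u(4) by (simp add: matrix_mul_assoc fg)
    have m: "move f g k = k ** (u ** g)"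
      by (simp add: move_def u_def)
    have "move f g k \<in> left_idempotents M g"
      unfolding left_idempotents_def m
      using \<open>u \<in> M\<close> k' g by (simp add: mult mult_right_assoc absorb3[OF gku] fg)
    moreover have fm: "f ** move f g k = u ** g"
      by (simp add: m absorb2[OF k'(2)] absorb2[OF u(1)])
    have "corner_unit g (f ** move f g k)" "corner_inv g (f ** move f g k) = g ** (k ** g)"
      unfolding fm
      by (rule corner_invI[where u = "g ** (k ** g)"];
          simp add: g fg mult_right_assoc absorb2[OF g(2)] absorb3[OF ugk])+
    moreover from this(2) have "move g f (move f g k) = k"
      unfolding move_def[of g f]
      by (simp add: m mult_right_assoc absorb2[OF g(2)] absorb3[OF ugk] ugk fg k' absorb2[OF k'(3)])
    ultimately show ?thesis by blast
  qed
  have hol: "open {x. corner_unit f (g ** unentries x)}"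
       "hol_matrix_on {x. corner_unit f (g ** unentries x)} (\<lambda>x. move f g (unentries x))" for f g
  proof -
    have g: "hol_matrix_on U (\<lambda>x. g ** unentries x)" for U
      by (intro hol_matrix_on_mult hol_matrix_on_const hol_matrix_on_unentries hol_map_on_id)
    note ch = corner_hol[OF g open_UNIV, of f, simplified]
    show "open {x. corner_unit f (g ** unentries x)}"
      by (rule ch)
    show "hol_matrix_on {x. corner_unit f (g ** unentries x)} (\<lambda>x. move f g (unentries x))"
      unfolding move_def
      by (intro hol_matrix_on_mult hol_matrix_on_const hol_matrix_on_unentries hol_map_on_id ch)
  qed
  have c0: "corner_unit f f" "corner_inv f f = f"
    using corner_invI[of f f f] f by auto
  show ?thesis
  proof (rule germ_iso_entriesI[OF hol[of f g] hol[of g f]])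
    show "f \<in> left_idempotents M f"
      using f by (simp add: left_idempotents_def)
    show "move f g f = g"
      by (simp add: move_def c0 f fg)
  qed (use c0 fg move[OF f g fg] move[OF g f fg(2,1)] in auto)
qed

lemma germ_iso_conjugate:
  assumes "x \<in> M" "y \<in> M" "x ** y = mat 1" "y ** x = mat 1" "f \<in> M" "f ** f = f"
  shows "germ_iso (entries ` left_idempotents M f) (entries f)
    (entries ` left_idempotents M (x ** (f ** y))) (entries (x ** (f ** y)))"
proof -
  have conj: "x ** (k ** y) \<in> left_idempotents M (x ** (f ** y))"
    if "k \<in> left_idempotents M f" "x \<in> M" "y \<in> M" "y ** x = mat 1" for x y k f
  proof -
    have k: "f ** k = f" "k ** f = k" "k \<in> M"
      using that by (auto simp: left_idempotents_def)
    then show ?thesis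
      using that by (simp add: left_idempotents_def mult mult_right_assoc
          absorb2[OF that(4)] absorb2[OF k(1)] absorb2[OF k(2)])
  qed
  have undo: "y ** ((x ** (k ** y)) ** x) = k" if "y ** x = mat 1" for x y k :: "complex ^ 'n ^ 'n"
    by (simp add: mult_right_assoc that absorb2[OF that])
  show ?thesis
  proof (rule germ_iso_entriesI[where P = "\<lambda>_. True" and Q = "\<lambda>_. True" and F = "\<lambda>k. x ** (k ** y)" and G = "\<lambda>k. y ** (k ** x)"])
    show "y ** (k ** x) \<in> left_idempotents M f \<and> True \<and> x ** ((y ** (k ** x)) ** y) = k"
      if "k \<in> left_idempotents M (x ** (f ** y))" for k
      using conj[OF that, of y x] undo[of x y] assms by (simp add: undo)
  qed (use assms conj undo in \<open>auto simp: left_idempotents_def intro!: hol_matrix_on_mult hol_matrix_on_const hol_matrix_on_unentries hol_map_on_id\<close>)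
qed

end

section \<open>Irreducibility and homogeneity\<close>

text \<open>Clearing denominators: a power of \<open>D\<close> makes a polynomial in the fractions \<open>N k / D\<close> a
  polynomial.\<close>
lemma polynomial_fun_compose_rational:
  fixes q :: "complex ^ 'k \<Rightarrow> complex" and D :: "complex ^ 'm \<Rightarrow> complex"
  assumes q: "polynomial_fun q" and N: "\<And>k. polynomial_fun (N k)" and D: "polynomial_fun D"
  shows "\<exists>n Q. polynomial_fun Q \<and> (\<forall>x. D x \<noteq> 0 \<longrightarrow> q (\<chi> k. N k x / D x) * D x ^ n = Q x)"
  using q
proof (induction rule: polynomial_fun.induct)
  case (const c)
  show ?case
    by (intro exI[of _ 0] exI[of _ "\<lambda>x. c"]) (auto intro: polynomial_fun.intros)
next
  case (coord k)
  show ?case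
    by (intro exI[of _ 1] exI[of _ "N k"]) (auto intro: N)
next
  case (add p q)
  then obtain n P m Q where *: "polynomial_fun P" "\<And>x. D x \<noteq> 0 \<Longrightarrow> p (\<chi> k. N k x / D x) * D x ^ n = P x"
    "polynomial_fun Q" "\<And>x. D x \<noteq> 0 \<Longrightarrow> q (\<chi> k. N k x / D x) * D x ^ m = Q x"
    by blast
  have "polynomial_fun (\<lambda>x. P x * D x ^ m + Q x * D x ^ n)"
    by (intro polynomial_fun.add polynomial_fun.mult polynomial_fun_power * D)
  moreover have "\<forall>x. D x \<noteq> 0 \<longrightarrow> (p (\<chi> k. N k x / D x) + q (\<chi> k. N k x / D x)) * D x ^ (n + m)
      = P x * D x ^ m + Q x * D x ^ n"
    by (simp add: *(2,4)[symmetric] algebra_simps power_add)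
  ultimately show ?case by (intro exI conjI)
next
  case (mult p q)
  then obtain n P m Q where *: "polynomial_fun P" "\<And>x. D x \<noteq> 0 \<Longrightarrow> p (\<chi> k. N k x / D x) * D x ^ n = P x"
    "polynomial_fun Q" "\<And>x. D x \<noteq> 0 \<Longrightarrow> q (\<chi> k. N k x / D x) * D x ^ m = Q x"
    by blast
  have "polynomial_fun (\<lambda>x. P x * Q x)"
    by (intro polynomial_fun.mult *)
  moreover have "\<forall>x. D x \<noteq> 0 \<longrightarrow> (p (\<chi> k. N k x / D x) * q (\<chi> k. N k x / D x)) * D x ^ (n + m) = P x * Q x"
    by (simp add: *(2,4)[symmetric] algebra_simps power_add)
  ultimately show ?case by (intro exI conjI)
qed

definition polynomial_matrix :: "(complex ^ 'm \<Rightarrow> complex ^ 'n ^ 'n) \<Rightarrow> bool" where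
  "polynomial_matrix A \<longleftrightarrow> (\<forall>i j. polynomial_fun (\<lambda>x. A x $ i $ j))"

lemma polynomial_matrix_const: "polynomial_matrix (\<lambda>x. C)"
  by (auto simp: polynomial_matrix_def intro: polynomial_fun.intros)

lemma polynomial_matrix_mult: "polynomial_matrix A \<Longrightarrow> polynomial_matrix B \<Longrightarrow> polynomial_matrix (\<lambda>x. A x ** B x)"
  unfolding polynomial_matrix_def matrix_matrix_mult_def
  by (auto intro!: polynomial_fun_sum polynomial_fun.mult)

lemma polynomial_matrix_add: "polynomial_matrix A \<Longrightarrow> polynomial_matrix B \<Longrightarrow> polynomial_matrix (\<lambda>x. A x + B x)"
  by (auto simp: polynomial_matrix_def intro!: polynomial_fun.add)

lemma polynomial_matrix_diff: "polynomial_matrix A \<Longrightarrow> polynomial_matrix B \<Longrightarrow> polynomial_matrix (\<lambda>x. A x - B x)"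
  by (auto simp: polynomial_matrix_def intro!: polynomial_fun_diff)

lemma polynomial_matrix_unentries: "polynomial_matrix unentries"
  by (auto simp: polynomial_matrix_def unentries_def intro: polynomial_fun.coord)

lemma polynomial_fun_det_matrix: "polynomial_matrix A \<Longrightarrow> polynomial_fun (\<lambda>x. det (A x))"
  by (auto simp: polynomial_matrix_def intro: polynomial_fun_det)

lemma polynomial_matrix_adjugate:
  assumes "polynomial_matrix A"
  shows "polynomial_matrix (\<lambda>x. adjugate (A x))"
proof -
  have "polynomial_fun (\<lambda>x. det (\<chi> i j. if j = k then (if i = l then 1 else 0) else A x $ i $ j))" for k l
  proof (rule polynomial_fun_det)
    fix i j
    show "polynomial_fun (\<lambda>x. (\<chi> i j. if j = k then (if i = l then 1 else 0) else A x $ i $ j) $ i $ j)"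
      using assms by (cases "j = k"; cases "i = l") (auto simp: polynomial_matrix_def intro: polynomial_fun.const)
  qed
  then show ?thesis
    by (simp add: polynomial_matrix_def adjugate_def)
qed

text \<open>Irreducibility enters only through the assumption \<open>generic\<close>: two open conditions that
  can each be met on \<open>M\<close> can be met simultaneously. In this form it passes easily to the transposed
  monoid.\<close>
locale regular_irreducible_monoid = regular_monoid M for M :: "(complex ^ 'n ^ 'n) set" +
  assumes algebraic: "algebraic_set (entries ` M)"
    and generic: "\<And>p q a b. polynomial_fun p \<Longrightarrow> polynomial_fun q \<Longrightarrow> a \<in> M \<Longrightarrow> p (entries a) \<noteq> 0 \<Longrightarrow>
       b \<in> M \<Longrightarrow> q (entries b) \<noteq> 0 \<Longrightarrow> \<exists>c\<in>M. p (entries c) \<noteq> 0 \<and> q (entries c) \<noteq> 0"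

lemma irreducible_generic:
  assumes Z: "algebraic_set Z" "irreducible_set Z" and p: "polynomial_fun p" and q: "polynomial_fun q"
    and "a \<in> Z" "p a \<noteq> 0" "b \<in> Z" "q b \<noteq> 0"
  shows "\<exists>c\<in>Z. p c \<noteq> 0 \<and> q c \<noteq> 0"
proof (rule ccontr)
  assume *: "\<not> ?thesis"
  have sub: "algebraic_set {x \<in> Z. r x = 0}" if "polynomial_fun r" for r
  proof -
    obtain P where P: "\<forall>p\<in>P. polynomial_fun p" "Z = {x. \<forall>p\<in>P. p x = 0}"
      using Z(1) unfolding algebraic_set_def by blast
    then show ?thesis
      unfolding algebraic_set_def using that by (intro exI[of _ "insert r P"]) auto
  qed
  have "Z = {x \<in> Z. p x = 0} \<union> {x \<in> Z. q x = 0}"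
    using * by auto
  moreover have "{x \<in> Z. p x = 0} \<subset> Z" "{x \<in> Z. q x = 0} \<subset> Z"
    using assms(5-) by auto
  ultimately show False
    using Z(2) sub[OF p] sub[OF q] unfolding irreducible_set_def by blast
qed

text \<open>The tangent dimension is defined for every \<open>f\<close>. For an idempotent \<open>f\<close> in \<open>M\<close> it is
  the dimension of the manifold \<open>left_idempotents M f\<close>, by \<open>left_idempotents_manifold\<close>.\<close>
definition left_dim :: "(complex ^ 'n ^ 'n) set \<Rightarrow> complex ^ 'n ^ 'n \<Rightarrow> nat" where
  "left_dim M f = vec.dim (tangent_vectors (entries ` left_idempotents M f) (entries f))"

lemma left_idempotents_idem: "k \<in> left_idempotents M f \<Longrightarrow> k ** k = k"
  unfolding left_idempotents_def by (metis (mono_tags, lifting) matrix_mul_assoc mem_Collect_eq)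

lemma left_idempotents_cong: "k \<in> left_idempotents M f \<Longrightarrow> left_idempotents M k = left_idempotents M f"
  by (rule left_idempotents_eq) (auto simp: left_idempotents_def)

context regular_irreducible_monoid
begin

lemma generic_unit:
  assumes "polynomial_fun p" "a \<in> M" "p (entries a) \<noteq> 0"
  obtains x y where "x \<in> M" "y \<in> M" "x ** y = mat 1" "y ** x = mat 1" "p (entries x) \<noteq> 0"
proof -
  have "polynomial_fun (\<lambda>x. det (unentries x))"
    by (rule polynomial_fun_det_matrix[OF polynomial_matrix_unentries])
  from generic[OF assms(1) this assms(2,3) one] obtain x where "x \<in> M" "p (entries x) \<noteq> 0" "det x \<noteq> 0"
    by auto
  with unit_inverse_mem that show thesis
    by metis
qed

lemma algebraic_left_idempotents: "algebraic_set (entries ` left_idempotents M f)"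
proof -
  obtain P where P: "\<forall>p\<in>P. polynomial_fun p" "entries ` M = {x. \<forall>p\<in>P. p x = 0}"
    using algebraic unfolding algebraic_set_def by blast
  define P1 where "P1 = (\<Union>i j. {\<lambda>x. (f ** unentries x - f) $ i $ j})"
  define P2 where "P2 = (\<Union>i j. {\<lambda>x. (unentries x ** f - unentries x) $ i $ j})"
  have poly: "polynomial_matrix (\<lambda>x. f ** unentries x - f)" "polynomial_matrix (\<lambda>x. unentries x ** f - unentries x)"
    by (intro polynomial_matrix_diff polynomial_matrix_mult polynomial_matrix_const polynomial_matrix_unentries)+
  then have "\<forall>p\<in>P \<union> P1 \<union> P2. polynomial_fun p"
    using P(1) by (auto simp: P1_def P2_def polynomial_matrix_def)
  moreover have "entries ` left_idempotents M f = {x. \<forall>p\<in>P \<union> P1 \<union> P2. p x = 0}"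
  proof -
    have "x \<in> entries ` left_idempotents M f \<longleftrightarrow> (\<forall>p\<in>P \<union> P1 \<union> P2. p x = 0)" for x
    proof -
      have "x \<in> entries ` left_idempotents M f \<longleftrightarrow>
          x \<in> entries ` M \<and> f ** unentries x - f = 0 \<and> unentries x ** f - unentries x = 0"
        by (auto simp: in_entries_image_iff left_idempotents_def)
      also have "\<dots> \<longleftrightarrow> (\<forall>p\<in>P. p x = 0) \<and> (\<forall>i j. (f ** unentries x - f) $ i $ j = 0) \<and>
          (\<forall>i j. (unentries x ** f - unentries x) $ i $ j = 0)"
        unfolding P(2) by (simp only: vec_eq_iff zero_index mem_Collect_eq)
      also have "\<dots> \<longleftrightarrow> (\<forall>p\<in>P \<union> P1 \<union> P2. p x = 0)"
        by (auto simp: P1_def P2_def ball_Un)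
      finally show ?thesis .
    qed
    then show ?thesis by blast
  qed
  ultimately show ?thesis
    unfolding algebraic_set_def by blast
qed

text \<open>The polynomial \<open>q\<close> marks points where the set is known to be a manifold. For a generic unit \<open>a\<close> of
  \<open>M\<close>, the idempotent \<open>h = a ** corner_inv f a\<close> has the image of \<open>g = a ** f ** inv a\<close> and the kernel of
  \<open>f\<close>, and \<open>q\<close> does not vanish at \<open>h\<close>. The germ at \<open>f\<close> is isomorphic to the one at \<open>g\<close> by conjugation
  and then to the one at \<open>h\<close>. For \<open>a\<close> in the set itself
  \<open>h = a\<close>, so some \<open>a \<in> M\<close> satisfies \<open>q h \<noteq> 0\<close>; by irreducibility some invertible \<open>a\<close> does.\<close>
theorem left_idempotents_manifold:
  assumes e: "e \<in> M" "e ** e = e" and f: "f \<in> left_idempotents M e"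
  shows "manifold_at (left_dim M e) (entries ` left_idempotents M e) (entries f)"
proof -
  let ?Z = "left_idempotents M e"
  have "entries e \<in> entries ` ?Z"
    using e by (auto simp: left_idempotents_def)
  then obtain d q where q: "polynomial_fun q" "\<exists>z\<in>entries ` ?Z. q z \<noteq> 0"
     and mf: "\<forall>p\<in>entries ` ?Z. q p \<noteq> 0 \<longrightarrow> manifold_at d (entries ` ?Z) p"
    using algebraic_set_generically_manifold[OF algebraic_left_idempotents, of e] by auto
  have main: "manifold_at d (entries ` ?Z) (entries f)" if f: "f \<in> ?Z" for f
  proof -
    have f': "f \<in> M" "f ** f = f" "left_idempotents M f = ?Z"
      using f left_idempotents_idem[OF f] left_idempotents_cong[OF f] by (auto simp: left_idempotents_def)
    define B where "B x = f ** unentries x ** f + (mat 1 - f)" for x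
    define N where "N x = unentries x ** (f ** adjugate (B x))" for x
    have polyB: "polynomial_matrix B"
      unfolding B_def[abs_def]
      by (intro polynomial_matrix_add polynomial_matrix_mult polynomial_matrix_const polynomial_matrix_unentries)
    have "polynomial_matrix N"
      unfolding N_def[abs_def]
      by (intro polynomial_matrix_mult polynomial_matrix_const polynomial_matrix_unentries polynomial_matrix_adjugate polyB)
    then have polyN: "polynomial_fun (\<lambda>x. N x $ fst k $ snd k)" for k
      by (auto simp: polynomial_matrix_def)
    have polyD: "polynomial_fun (\<lambda>x. det (B x))"
      by (rule polynomial_fun_det_matrix[OF polyB])
    have rat: "entries (unentries x ** corner_inv f (unentries x)) = (\<chi> k. N x $ fst k $ snd k / det (B x))"
      if "det (B x) \<noteq> 0" for x
    proof -
      have scale: "X ** (\<chi> k l. C $ k $ l / c) = (\<chi> k l. (X ** C) $ k $ l / c)"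
        for X C :: "complex ^ 'n ^ 'n" and c
        by (simp add: matrix_matrix_mult_def vec_eq_iff sum_divide_distrib)
      have "unentries x ** corner_inv f (unentries x) = unentries x ** (f ** matrix_inv (B x))"
        by (simp only: corner_inv_def B_def)
      also have "\<dots> = (\<chi> k l. N x $ k $ l / det (B x))"
        by (simp only: matrix_inv_adjugate[OF that] scale N_def)
      finally show ?thesis
        by (simp add: entries_def)
    qed
    obtain n Q where Q: "polynomial_fun Q"
      "\<forall>x. det (B x) \<noteq> 0 \<longrightarrow> q (\<chi> k. N x $ fst k $ snd k / det (B x)) * det (B x) ^ n = Q x"
      using polynomial_fun_compose_rational[OF q(1), of "\<lambda>k x. N x $ fst k $ snd k" "\<lambda>x. det (B x)", OF polyN polyD]
      by (elim exE conjE)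
    then have Q': "q (entries (unentries x ** corner_inv f (unentries x))) * det (B x) ^ n = Q x"
      if "det (B x) \<noteq> 0" for x
      using rat[OF that] that by simp
    have BU: "det (B (entries a)) \<noteq> 0 \<longleftrightarrow> corner_unit f a" for a
      by (simp add: B_def corner_unit_def)
    obtain k where k: "k \<in> ?Z" "q (entries k) \<noteq> 0"
      using q(2) by blast
    then have k': "k \<in> M" "f ** k = f" "k ** f = k"
      using f'(3) by (auto simp: left_idempotents_def)
    have ck: "corner_unit f k" "corner_inv f k = f"
      using corner_invI[of f f k] k' f' by auto
    have "Q (entries k) * det (B (entries k)) \<noteq> 0"
      using Q'[of "entries k"] ck k k' BU[of k] by auto
    with polynomial_fun.mult[OF Q(1) polyD] k'(1) obtain a b where
      ab: "a \<in> M" "b \<in> M" "a ** b = mat 1" "b ** a = mat 1" "Q (entries a) * det (B (entries a)) \<noteq> 0"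
      by (rule generic_unit)
    then have cu: "corner_unit f a"
      using BU by auto
    define u where "u = corner_inv f a"
    have u: "u \<in> M" "f ** u = u" "u ** f = u" "u ** (a ** f) = f" "f ** (a ** u) = f"
      unfolding u_def using corner_inv_mem corner_inv cu f' ab(1) by auto
    define g where "g = a ** (f ** b)"
    define h where "h = a ** u"
    have h: "h \<in> left_idempotents M f"
      unfolding left_idempotents_def h_def using u ab mult by (simp add: mult_right_assoc)
    have "q (entries h) \<noteq> 0"
      using Q'[of "entries a"] cu BU[of a] ab(5) unfolding h_def u_def by auto
    then have mh: "manifold_at d (entries ` ?Z) (entries h)"
      using mf h f'(3) by auto
    have g: "g \<in> M" "g ** g = g"
      unfolding g_def using ab f' mult
      by (simp_all add: mult_right_assoc absorb2[OF ab(4)] absorb2[OF f'(2)])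
    have gh: "g ** h = h" "h ** g = g"
      unfolding g_def h_def
      by (simp_all add: mult_right_assoc absorb2[OF ab(4)] u absorb3[OF u(4)])
    have "germ_iso (entries ` left_idempotents M g) (entries g) (entries ` left_idempotents M h) (entries h)"
      using germ_iso_right_related[OF g _ _ gh] h left_idempotents_idem[OF h] by (auto simp: left_idempotents_def)
    moreover have "germ_iso (entries ` left_idempotents M f) (entries f) (entries ` left_idempotents M g) (entries g)"
      unfolding g_def using germ_iso_conjugate[OF ab(1-4) f'(1,2)] .
    ultimately have "germ_iso (entries ` ?Z) (entries f) (entries ` left_idempotents M h) (entries h)"
      using germ_iso_trans f'(3) by metis
    then show ?thesis
      using manifold_at_germ_iso mh left_idempotents_cong[OF h] f'(3) by metis
  qed
  have "e \<in> ?Z"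
    using e by (simp add: left_idempotents_def)
  then have "left_dim M e = d"
    unfolding left_dim_def by (intro manifold_at_dim main)
  with main[OF f] show ?thesis by simp
qed

lemma left_dim_right_related:
  assumes "f \<in> M" "f ** f = f" "g \<in> M" "g ** g = g" "f ** g = g" "g ** f = f"
  shows "left_dim M f = left_dim M g"
proof -
  have "manifold_at (left_dim M g) (entries ` left_idempotents M g) (entries g)"
    using assms by (intro left_idempotents_manifold) (auto simp: left_idempotents_def)
  from manifold_at_germ_iso[OF germ_iso_right_related[OF assms] this] show ?thesis
    unfolding left_dim_def[of M f] by (rule manifold_at_dim)
qed

lemma left_dim_conjugate:
  assumes "x \<in> M" "y \<in> M" "x ** y = mat 1" "y ** x = mat 1" "f \<in> M" "f ** f = f"
  shows "left_dim M (x ** (f ** y)) = left_dim M f"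
proof -
  have "manifold_at (left_dim M f) (entries ` left_idempotents M f) (entries f)"
    using assms by (intro left_idempotents_manifold) (auto simp: left_idempotents_def)
  from manifold_at_germ_iso[OF germ_iso_sym[OF germ_iso_conjugate[OF assms]] this] show ?thesis
    unfolding left_dim_def[of M "x ** (f ** y)"] by (rule manifold_at_dim)
qed

lemma left_dim_left_related:
  assumes "f \<in> M" "f ** f = f" "g \<in> M" "f ** g = f" "g ** f = g"
  shows "left_dim M f = left_dim M g"
proof -
  have "manifold_at (left_dim M f) (entries ` left_idempotents M f) (entries g)"
    using assms by (intro left_idempotents_manifold) (auto simp: left_idempotents_def)
  then show ?thesis
    unfolding left_dim_def[of M g] left_idempotents_eq[OF assms(4,5), of M, symmetric]
    by (rule manifold_at_dim[symmetric])
qed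

end

section \<open>Transposition\<close>

text \<open>This is the matrix transposition in the coordinates of \<open>entries\<close>.\<close>
definition flip :: "complex ^ ('n::finite \<times> 'n) \<Rightarrow> complex ^ ('n \<times> 'n)" where
  "flip x = (\<chi> k. x $ (snd k, fst k))"

lemma flip_flip [simp]: "flip (flip x) = x"
  by (simp add: flip_def vec_eq_iff)

lemma entries_transpose: "entries (transpose A) = flip (entries A)"
  by (simp add: flip_def entries_def transpose_def vec_eq_iff)

lemma hol_map_on_flip: "hol_map_on U flip"
  by (auto simp: hol_map_on_iff flip_def)

lemma polynomial_fun_flip: "polynomial_fun p \<Longrightarrow> polynomial_fun (\<lambda>x. p (flip x))"
  by (induction rule: polynomial_fun.induct) (auto simp: flip_def intro: polynomial_fun.intros)

lemma in_transpose_image_iff: "k \<in> transpose ` S \<longleftrightarrow> transpose k \<in> S"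
  by (metis image_iff transpose_transpose)

lemma entries_transpose_image: "entries ` transpose ` S = flip -` (entries ` S)"
proof -
  have "x \<in> entries ` transpose ` S \<longleftrightarrow> flip x \<in> entries ` S" for x
    by (auto simp: image_image entries_transpose image_iff) (metis flip_flip)+
  then show ?thesis
    by auto
qed

lemma germ_iso_transpose:
  assumes "p \<in> S"
  shows "germ_iso (entries ` S) (entries p) (entries ` transpose ` S) (entries (transpose p))"
  by (rule germ_isoI[OF open_UNIV open_UNIV _ _ _ _ hol_map_on_flip hol_map_on_flip])
     (use assms in \<open>auto simp: entries_transpose entries_transpose_image\<close>)

lemma right_idempotents_transpose:
  "left_idempotents (transpose ` M) (transpose f) = transpose ` right_idempotents M f"
proof -
  have "k \<in> left_idempotents (transpose ` M) (transpose f) \<longleftrightarrow> transpose k \<in> right_idempotents M f" for k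
  proof -
    have "transpose f ** k = transpose f \<longleftrightarrow> transpose k ** f = f"
      by (metis matrix_transpose_mul transpose_transpose)
    moreover have "k ** transpose f = k \<longleftrightarrow> f ** transpose k = transpose k"
      by (metis matrix_transpose_mul transpose_transpose)
    ultimately show ?thesis
      by (auto simp: left_idempotents_def right_idempotents_def in_transpose_image_iff)
  qed
  then show ?thesis
    by (simp add: set_eq_iff in_transpose_image_iff)
qed

lemma (in regular_irreducible_monoid) transpose_monoid: "regular_irreducible_monoid (transpose ` M)"
proof
  show "mat 1 \<in> transpose ` M"
    using one by (metis image_eqI transpose_mat)
  show "a ** b \<in> transpose ` M" if "a \<in> transpose ` M" "b \<in> transpose ` M" for a b
    using that mult by (auto simp flip: matrix_transpose_mul)
  show "\<exists>x\<in>transpose ` M. a ** (x ** a) = a" if "a \<in> transpose ` M" for a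
  proof -
    obtain b where b: "b \<in> M" "a = transpose b"
      using \<open>a \<in> transpose ` M\<close> by blast
    then obtain x where "x \<in> M" "b ** (x ** b) = b"
      using regular by blast
    then show ?thesis
      using b(2) by (intro bexI[of _ "transpose x"]) (auto simp: matrix_mul_assoc simp flip: matrix_transpose_mul)
  qed
  obtain P where P: "\<forall>p\<in>P. polynomial_fun p" "entries ` M = {x. \<forall>p\<in>P. p x = 0}"
    using algebraic unfolding algebraic_set_def by blast
  show "algebraic_set (entries ` transpose ` M)"
    unfolding algebraic_set_def entries_transpose_image P(2)
    by (intro exI[of _ "(\<lambda>p x. p (flip x)) ` P"]) (use P(1) polynomial_fun_flip in auto)
  fix p q a b
  assume p: "polynomial_fun p" "a \<in> transpose ` M" "p (entries a) \<noteq> 0"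
    and q: "polynomial_fun q" "b \<in> transpose ` M" "q (entries b) \<noteq> 0"
  then obtain a' b' where "a' \<in> M" "a = transpose a'" "b' \<in> M" "b = transpose b'"
    by blast
  with generic[OF polynomial_fun_flip[OF p(1)] polynomial_fun_flip[OF q(1)], of a' b'] p q
  obtain c where "c \<in> M" "p (entries (transpose c)) \<noteq> 0" "q (entries (transpose c)) \<noteq> 0"
    by (auto simp: entries_transpose)
  then show "\<exists>c\<in>transpose ` M. p (entries c) \<noteq> 0 \<and> q (entries c) \<noteq> 0"
    by blast
qed

definition right_dim :: "(complex ^ 'n ^ 'n) set \<Rightarrow> complex ^ 'n ^ 'n \<Rightarrow> nat" where
  "right_dim M f = left_dim (transpose ` M) (transpose f)"

context regular_irreducible_monoid
begin

lemma transpose_idem: "(f :: complex ^ 'n ^ 'n) ** f = f \<Longrightarrow> transpose f ** transpose f = transpose f"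
  by (simp flip: matrix_transpose_mul)

lemma right_idempotents_manifold:
  assumes "e \<in> M" "e ** e = e" "f \<in> right_idempotents M e"
  shows "manifold_at (right_dim M e) (entries ` right_idempotents M e) (entries f)"
proof -
  have "manifold_at (right_dim M e) (entries ` left_idempotents (transpose ` M) (transpose e)) (entries (transpose f))"
    unfolding right_dim_def
    by (intro regular_irreducible_monoid.left_idempotents_manifold transpose_monoid)
       (use assms in \<open>auto simp: right_idempotents_transpose transpose_idem\<close>)
  then show ?thesis
    unfolding right_idempotents_transpose
    using manifold_at_germ_iso[OF germ_iso_transpose[OF assms(3)]] by blast
qed

lemma right_dim_right_related:
  assumes "f \<in> M" "f ** f = f" "g \<in> M" "f ** g = g" "g ** f = f"
  shows "right_dim M f = right_dim M g"
  unfolding right_dim_def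
  by (intro regular_irreducible_monoid.left_dim_left_related transpose_monoid)
     (use assms in \<open>auto simp: transpose_idem simp flip: matrix_transpose_mul\<close>)

lemma right_dim_conjugate:
  assumes "x \<in> M" "y \<in> M" "x ** y = mat 1" "y ** x = mat 1" "f \<in> M" "f ** f = f"
  shows "right_dim M (x ** (f ** y)) = right_dim M f"
proof -
  have "left_dim (transpose ` M) (transpose y ** (transpose f ** transpose x)) = left_dim (transpose ` M) (transpose f)"
    by (intro regular_irreducible_monoid.left_dim_conjugate transpose_monoid)
       (use assms in \<open>auto simp: transpose_idem transpose_mat simp flip: matrix_transpose_mul\<close>)
  then show ?thesis
    by (simp add: right_dim_def matrix_transpose_mul matrix_mul_assoc)
qed

lemma right_dim_left_related:
  assumes "f \<in> M" "f ** f = f" "g \<in> M" "g ** g = g" "f ** g = f" "g ** f = g"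
  shows "right_dim M f = right_dim M g"
  unfolding right_dim_def
  by (intro regular_irreducible_monoid.left_dim_right_related transpose_monoid)
     (use assms in \<open>auto simp: transpose_idem simp flip: matrix_transpose_mul\<close>)

section \<open>Constancy of the dimensions on a D-class\<close>

text \<open>Here \<open>f \<L> a \<R> g\<close>, with inverse \<open>b\<close> of \<open>a\<close>. The \<open>\<H>\<close>-class of \<open>a\<close> need not contain an idempotent.
  That of \<open>a ** y\<close> does as soon as \<open>a ** y\<close> is invertible in the corner of \<open>g\<close>; this holds for \<open>y = b\<close> and
  therefore for some invertible \<open>y\<close>. The resulting idempotent \<open>h\<close> has the image of \<open>g\<close> and the
  kernel of the conjugate \<open>f' = inv y ** f ** y\<close>.\<close>
lemma dims_D_related:
  assumes f: "f \<in> M" "f ** f = f" and g: "g \<in> M" "g ** g = g"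
    and a: "a \<in> M" "a ** f = a" "g ** a = a" and b: "b \<in> M" "a ** b = g" "b ** a = f"
  shows "left_dim M f = left_dim M g \<and> right_dim M f = right_dim M g"
proof -
  have "polynomial_fun (\<lambda>x. det (g ** (a ** unentries x) ** g + (mat 1 - g)))"
    by (intro polynomial_fun_det_matrix polynomial_matrix_add polynomial_matrix_mult polynomial_matrix_const
        polynomial_matrix_unentries)
  moreover note b(1)
  moreover have "det (g ** (a ** unentries (entries b)) ** g + (mat 1 - g)) \<noteq> 0"
    by (simp add: b g)
  ultimately obtain y z where yz: "y \<in> M" "z \<in> M" "y ** z = mat 1" "z ** y = mat 1"
    and "det (g ** (a ** unentries (entries y)) ** g + (mat 1 - g)) \<noteq> 0"
    by (rule generic_unit)
  then have cu: "corner_unit g (a ** y)"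
    by (simp add: corner_unit_def)
  define w where "w = corner_inv g (a ** y)"
  have w: "w \<in> M" "g ** w = w" "w ** g = w" "w ** (a ** (y ** g)) = g" "a ** (y ** w) = g"
  proof -
    note cw = corner_inv[OF g(2) cu, folded w_def, unfolded mult_right_assoc]
    show "w \<in> M"
      unfolding w_def by (intro corner_inv_mem g mult a yz cu)
    show "g ** w = w" "w ** g = w" "w ** (a ** (y ** g)) = g"
      by (fact cw)+
    show "a ** (y ** w) = g"
      using cw(4) by (simp add: absorb2[OF a(3)])
  qed
  define f' where "f' = z ** (f ** y)"
  define h where "h = w ** (a ** y)"
  have f': "f' \<in> M" "f' ** f' = f'"
    unfolding f'_def using mult yz f by (simp_all add: mult_right_assoc absorb2[OF yz(3)] absorb2[OF f(2)])
  have "h \<in> M"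
    unfolding h_def by (intro mult w yz a)
  have wayw: "w ** (a ** (y ** (w ** t))) = w ** t" for t :: "complex ^ 'n ^ 'n"
  proof -
    have "w ** (a ** (y ** (w ** t))) = w ** ((a ** (y ** w)) ** t)"
      by (simp add: mult_right_assoc)
    then show ?thesis
      by (simp add: w(5) absorb2[OF w(3)])
  qed
  have hh: "h ** h = h"
    by (simp add: h_def mult_right_assoc wayw)
  have gh: "g ** h = h"
    by (simp add: h_def absorb2[OF w(2)])
  have hg: "h ** g = g"
    by (simp add: h_def mult_right_assoc w)
  have hf': "h ** f' = h"
    by (simp add: h_def f'_def mult_right_assoc absorb2[OF yz(3)] absorb2[OF a(2)])
  have f'h: "f' ** h = f'"
  proof -
    have ayh: "a ** (y ** h) = a ** y"
    proof -
      have "a ** (y ** h) = (a ** (y ** w)) ** (a ** y)"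
        by (simp add: h_def mult_right_assoc)
      then show ?thesis
        by (simp add: w(5) absorb2[OF a(3)])
    qed
    have "f ** (y ** h) = f ** y"
      unfolding b(3)[symmetric] by (simp add: mult_right_assoc ayh)
    then show ?thesis
      by (simp add: f'_def mult_right_assoc)
  qed
  have "left_dim M f = left_dim M f'" "right_dim M f = right_dim M f'"
    unfolding f'_def using left_dim_conjugate right_dim_conjugate yz f by simp_all
  moreover have "left_dim M f' = left_dim M h" "right_dim M f' = right_dim M h"
    using left_dim_left_related[OF f' \<open>h \<in> M\<close> f'h hf'] right_dim_left_related[OF f' \<open>h \<in> M\<close> hh f'h hf'] .
  moreover have "left_dim M h = left_dim M g" "right_dim M h = right_dim M g"
    using left_dim_right_related[OF \<open>h \<in> M\<close> hh g hg gh] right_dim_right_related[OF \<open>h \<in> M\<close> hh g(1) hg gh] .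
  ultimately show ?thesis by simp
qed

end

context regular_monoid
begin

lemma green_L_iff: "(a, b) \<in> green_L M \<longleftrightarrow> a \<in> M \<and> b \<in> M \<and> (\<exists>z\<in>M. a = z ** b) \<and> (\<exists>z\<in>M. b = z ** a)"
proof
  assume "(a, b) \<in> green_L M"
  then have *: "a \<in> M" "b \<in> M" "(\<lambda>x. x ** a) ` M = (\<lambda>x. x ** b) ` M"
    by (auto simp: green_L_def)
  have "c \<in> (\<lambda>x. x ** c) ` M" for c
    using one by (metis image_eqI matrix_mul_lid)
  with *(3) have "a \<in> (\<lambda>x. x ** b) ` M" "b \<in> (\<lambda>x. x ** a) ` M"
    by blast+
  with * show "a \<in> M \<and> b \<in> M \<and> (\<exists>z\<in>M. a = z ** b) \<and> (\<exists>z\<in>M. b = z ** a)"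
    by blast
next
  assume "a \<in> M \<and> b \<in> M \<and> (\<exists>z\<in>M. a = z ** b) \<and> (\<exists>z\<in>M. b = z ** a)"
  then obtain z z' where "a \<in> M" "b \<in> M" "z \<in> M" "z' \<in> M" "a = z ** b" "b = z' ** a"
    by blast
  moreover have "(\<lambda>x. x ** c) ` M \<subseteq> (\<lambda>x. x ** d) ` M" if "c = z ** d" "z \<in> M" for c d z
  proof clarify
    fix x assume "x \<in> M"
    then show "x ** c \<in> (\<lambda>x. x ** d) ` M"
      using that mult by (intro image_eqI[of _ _ "x ** z"]) (auto simp: matrix_mul_assoc)
  qed
  ultimately show "(a, b) \<in> green_L M"
    unfolding green_L_def by blast
qed

lemma green_R_iff: "(a, b) \<in> green_R M \<longleftrightarrow> a \<in> M \<and> b \<in> M \<and> (\<exists>z\<in>M. a = b ** z) \<and> (\<exists>z\<in>M. b = a ** z)"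
proof
  assume "(a, b) \<in> green_R M"
  then have *: "a \<in> M" "b \<in> M" "(\<lambda>x. a ** x) ` M = (\<lambda>x. b ** x) ` M"
    by (auto simp: green_R_def)
  have "c \<in> (\<lambda>x. c ** x) ` M" for c
    using one by (metis image_eqI matrix_mul_rid)
  with *(3) have "a \<in> (\<lambda>x. b ** x) ` M" "b \<in> (\<lambda>x. a ** x) ` M"
    by blast+
  with * show "a \<in> M \<and> b \<in> M \<and> (\<exists>z\<in>M. a = b ** z) \<and> (\<exists>z\<in>M. b = a ** z)"
    by blast
next
  assume "a \<in> M \<and> b \<in> M \<and> (\<exists>z\<in>M. a = b ** z) \<and> (\<exists>z\<in>M. b = a ** z)"
  then obtain z z' where "a \<in> M" "b \<in> M" "z \<in> M" "z' \<in> M" "a = b ** z" "b = a ** z'"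
    by blast
  moreover have "(\<lambda>x. c ** x) ` M \<subseteq> (\<lambda>x. d ** x) ` M" if "c = d ** z" "z \<in> M" for c d z
  proof clarify
    fix x assume "x \<in> M"
    then show "c ** x \<in> (\<lambda>x. d ** x) ` M"
      using that mult by (intro image_eqI[of _ _ "z ** x"]) (auto simp: matrix_mul_assoc)
  qed
  ultimately show "(a, b) \<in> green_R M"
    unfolding green_R_def by blast
qed

lemma idempotents_L_class:
  assumes "e \<in> M" "e ** e = e"
  shows "idempotents (L_class M e) = left_idempotents M e"
proof -
  have "k ** k = k \<and> (e, k) \<in> green_L M \<longleftrightarrow> k \<in> left_idempotents M e" for k
  proof
    assume "k ** k = k \<and> (e, k) \<in> green_L M"
    then obtain z z' where "k \<in> M" "k ** k = k" "e = z ** k" "k = z' ** e"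
      unfolding green_L_iff by blast
    then show "k \<in> left_idempotents M e"
      unfolding left_idempotents_def using assms(2) by (metis (mono_tags, lifting) matrix_mul_assoc mem_Collect_eq)
  next
    assume k: "k \<in> left_idempotents M e"
    then show "k ** k = k \<and> (e, k) \<in> green_L M"
      using left_idempotents_idem[OF k] assms unfolding green_L_iff left_idempotents_def by force
  qed
  then show ?thesis
    by (auto simp: idempotents_def L_class_def)
qed

lemma right_idempotents_idem: "h \<in> right_idempotents M f \<Longrightarrow> h ** h = h"
  unfolding right_idempotents_def by (metis (mono_tags, lifting) matrix_mul_assoc mem_Collect_eq)

lemma idempotents_R_class:
  assumes "e \<in> M" "e ** e = e"
  shows "idempotents (R_class M e) = right_idempotents M e"
proof -
  have "k ** k = k \<and> (e, k) \<in> green_R M \<longleftrightarrow> k \<in> right_idempotents M e" for k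
  proof
    assume "k ** k = k \<and> (e, k) \<in> green_R M"
    then obtain z z' where "k \<in> M" "k ** k = k" "e = k ** z" "k = e ** z'"
      unfolding green_R_iff by blast
    then show "k \<in> right_idempotents M e"
      unfolding right_idempotents_def using assms(2) by (metis (mono_tags, lifting) matrix_mul_assoc mem_Collect_eq)
  next
    assume k: "k \<in> right_idempotents M e"
    then show "k ** k = k \<and> (e, k) \<in> green_R M"
      using right_idempotents_idem[OF k] assms unfolding green_R_iff right_idempotents_def by force
  qed
  then show ?thesis
    by (auto simp: idempotents_def R_class_def)
qed

lemma equiv_carrier: "equiv M (M \<times> M)" "green_L M \<subseteq> M \<times> M" "green_R M \<subseteq> M \<times> M"
  by (auto intro!: equivI refl_onI symI transI simp: green_L_def green_R_def)

lemma green_D_mem: "(a, b) \<in> green_D M \<Longrightarrow> a \<in> M \<and> b \<in> M"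
  using equiv_carrier unfolding green_D_def by blast

lemma green_D_L: "(a, b) \<in> green_L M \<Longrightarrow> (a, b) \<in> green_D M"
  unfolding green_D_def by blast

lemma green_D_R: "(a, b) \<in> green_R M \<Longrightarrow> (a, b) \<in> green_D M"
  unfolding green_D_def by blast

lemma green_D_trans: "(a, b) \<in> green_D M \<Longrightarrow> (b, c) \<in> green_D M \<Longrightarrow> (a, c) \<in> green_D M"
  unfolding green_D_def equiv_def by (blast dest: transD)

lemma green_D_sym: "(a, b) \<in> green_D M \<Longrightarrow> (b, a) \<in> green_D M"
  unfolding green_D_def equiv_def by (blast dest: symD)

lemma exists_L_related_idempotent:
  assumes "a \<in> M"
  shows "\<exists>f\<in>M. f ** f = f \<and> (f, a) \<in> green_L M"
proof -
  obtain x where x: "x \<in> M" "a ** (x ** a) = a"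
    using regular assms by blast
  then have "(x ** a) ** (x ** a) = x ** a" "a = a ** (x ** a)"
    by (simp_all add: mult_right_assoc)
  then show ?thesis
    using assms mult x(1) unfolding green_L_iff by blast
qed

lemma exists_R_related_idempotent:
  assumes "a \<in> M"
  shows "\<exists>g\<in>M. g ** g = g \<and> (g, a) \<in> green_R M"
proof -
  obtain x where x: "x \<in> M" "a ** (x ** a) = a"
    using regular assms by blast
  have "(a ** x) ** (a ** x) = a ** x" "(a ** x) ** a = a"
    using x(2) by (metis matrix_mul_assoc)+
  then show ?thesis
    using assms mult x(1) by (intro bexI[of _ "a ** x"]) (auto simp: green_R_iff intro: sym)
qed

end

context regular_irreducible_monoid
begin

lemma dims_L_R_related:
  assumes f: "f \<in> M" "f ** f = f" "(f, a) \<in> green_L M" and g: "g \<in> M" "g ** g = g" "(g, a) \<in> green_R M"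
  shows "left_dim M f = left_dim M g \<and> right_dim M f = right_dim M g"
proof -
  obtain z z' where z: "z \<in> M" "f = z ** a" "a = z' ** f" "a \<in> M"
    using f(3) by (auto simp: green_L_iff)
  obtain y y' where y: "y \<in> M" "g = a ** y" "a = g ** y'"
    using g(3) by (auto simp: green_R_iff)
  obtain a' where a': "a' \<in> M" "a ** (a' ** a) = a"
    using regular z(4) by blast
  have af: "a ** f = a" and ga: "g ** a = a"
    using z(3) y(3) f(2) g(2) by (metis matrix_mul_assoc)+
  define b where "b = f ** (a' ** g)"
  have "b \<in> M"
    unfolding b_def by (intro mult f g a')
  moreover have "a ** b = g"
  proof -
    have "a ** b = a ** (a' ** g)"
      unfolding b_def by (simp add: absorb2[OF af])
    also have "\<dots> = g"
      unfolding y(2) by (simp add: absorb3[OF a'(2)])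
    finally show ?thesis .
  qed
  moreover have "b ** a = f"
  proof -
    have "b ** a = f ** (a' ** a)"
      by (simp add: b_def mult_right_assoc ga)
    also have "\<dots> = f"
      unfolding z(2) by (simp add: mult_right_assoc a'(2))
    finally show ?thesis .
  qed
  ultimately show ?thesis
    using dims_D_related[OF f(1,2) g(1,2) z(4) af ga] by blast
qed

text \<open>The relation \<open>\<D>\<close> is the least equivalence relation that contains \<open>\<L>\<close> and \<open>\<R>\<close>. So it suffices to
  extend the pair of dimensions to an invariant of all elements of \<open>M\<close>, through an arbitrary
  idempotent \<open>\<iota> a\<close> in the \<open>\<L>\<close>-class of \<open>a\<close>, and to verify that it is constant on \<open>\<L>\<close>- and \<open>\<R>\<close>-classes.\<close>
lemma dims_D_class:
  assumes "(e, f) \<in> green_D M" "e ** e = e" "f ** f = f"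
  shows "left_dim M e = left_dim M f \<and> right_dim M e = right_dim M f"
proof -
  define \<iota> where "\<iota> a = (SOME f. f \<in> M \<and> f ** f = f \<and> (f, a) \<in> green_L M)" for a
  define \<delta> where "\<delta> a = (left_dim M (\<iota> a), right_dim M (\<iota> a))" for a
  have \<iota>: "\<iota> a \<in> M \<and> \<iota> a ** \<iota> a = \<iota> a \<and> (\<iota> a, a) \<in> green_L M" if "a \<in> M" for a
    unfolding \<iota>_def by (rule someI_ex) (use exists_L_related_idempotent[OF that] in blast)
  define r where "r = {(a, b). a \<in> M \<and> b \<in> M \<and> \<delta> a = \<delta> b}"
  have "equiv M r"
    by (auto simp: r_def intro!: equivI refl_onI symI transI)
  moreover have "green_L M \<subseteq> r"
  proof clarify
    fix a b assume ab: "(a, b) \<in> green_L M"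
    then have "(f, a) \<in> green_L M \<longleftrightarrow> (f, b) \<in> green_L M" for f
      by (auto simp: green_L_def)
    then have "\<iota> a = \<iota> b"
      by (simp add: \<iota>_def)
    then show "(a, b) \<in> r"
      using ab by (simp add: r_def \<delta>_def green_L_iff)
  qed
  moreover have "green_R M \<subseteq> r"
  proof clarify
    fix a b assume ab: "(a, b) \<in> green_R M"
    then have "a \<in> M" "b \<in> M"
      by (auto simp: green_R_iff)
    obtain g where g: "g \<in> M" "g ** g = g" "(g, a) \<in> green_R M"
      using exists_R_related_idempotent \<open>a \<in> M\<close> by blast
    then have "(g, b) \<in> green_R M"
      using ab by (auto simp: green_R_def)
    then have "\<delta> a = \<delta> b"
      using dims_L_R_related[OF _ _ _ g, of "\<iota> a"] dims_L_R_related[OF _ _ _ g(1,2), of "\<iota> b" b]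
        \<iota>[OF \<open>a \<in> M\<close>] \<iota>[OF \<open>b \<in> M\<close>] by (simp add: \<delta>_def)
    then show "(a, b) \<in> r"
      using \<open>a \<in> M\<close> \<open>b \<in> M\<close> by (simp add: r_def)
  qed
  ultimately have "(e, f) \<in> r"
    using assms(1) unfolding green_D_def by blast
  then have "\<delta> e = \<delta> f" "e \<in> M" "f \<in> M"
    by (auto simp: r_def)
  moreover have "\<delta> g = (left_dim M g, right_dim M g)" if "g \<in> M" "g ** g = g" for g
    using dims_L_R_related[of "\<iota> g" g g] \<iota>[OF that(1)] that by (auto simp: \<delta>_def green_R_def)
  ultimately show ?thesis
    using assms(2,3) by simp
qed

end

section \<open>The product structure of a D-class near an idempotent\<close>

context regular_monoid
begin

text \<open>An idempotent \<open>x\<close> that is invertible in the corner of \<open>e\<close> could have larger rank than \<open>e\<close>. The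
  difference \<open>x - x ** u ** x\<close> is again idempotent and measures this; the condition \<open>near\<close> says that it does not
  have the eigenvalue \<open>1\<close>, so it is zero.\<close>
lemma idempotent_near:
  fixes x :: "complex ^ 'n ^ 'n"
  assumes e: "e \<in> M" "e ** e = e" and x: "x \<in> M" "x ** x = x" and cu: "corner_unit e x"
    and near: "det (mat 1 - (x - x ** (corner_inv e x ** x))) \<noteq> 0"
  defines "u \<equiv> corner_inv e x"
  shows "x ** u \<in> left_idempotents M e" "u ** x \<in> right_idempotents M e"
    "corner_unit e (u ** x ** (x ** u))" "x ** u ** (corner_inv e (u ** x ** (x ** u)) ** (u ** x)) = x"
    "(e, x) \<in> green_D M"
proof -
  have "u \<in> M"
    unfolding u_def by (intro corner_inv_mem e x cu)
  note u = corner_inv[OF e(2) cu, folded u_def]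
  have uxu: "u ** (x ** u) = u"
    by (metis u(2,4) matrix_mul_assoc)
  define y where "y = x - x ** (u ** x)"
  have "y ** (mat 1 - y) = 0"
    by (simp add: y_def matrix_distribs mult_right_assoc x absorb2[OF x(2)] absorb3[OF uxu])
  then have "y ** ((mat 1 - y) ** matrix_inv (mat 1 - y)) = 0 ** matrix_inv (mat 1 - y)"
    by (simp only: matrix_mul_assoc)
  moreover have "(mat 1 - y) ** matrix_inv (mat 1 - y) = mat 1"
    by (rule matrix_inv_right) (use near in \<open>simp add: y_def u_def\<close>)
  ultimately have "y = 0"
    by simp
  then have xux: "x ** (u ** x) = x"
    by (simp add: y_def)
  show "x ** u \<in> left_idempotents M e" "u ** x \<in> right_idempotents M e"
    using x \<open>u \<in> M\<close> mult u by (auto simp: left_idempotents_def right_idempotents_def mult_right_assoc absorb2[OF u(1)])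
  have uxxu: "u ** x ** (x ** u) = u"
    by (simp add: mult_right_assoc absorb2[OF x(2)] uxu)
  have ci: "corner_unit e u" "corner_inv e u = e ** (x ** e)"
    by (rule corner_invI[where u = "e ** (x ** e)"];
        simp add: mult_right_assoc e absorb2[OF e(2)] absorb2[OF u(1)] absorb2[OF u(2)] u)+
  show "corner_unit e (u ** x ** (x ** u))"
    unfolding uxxu by (fact ci)
  show "x ** u ** (corner_inv e (u ** x ** (x ** u)) ** (u ** x)) = x"
    unfolding uxxu ci by (simp add: mult_right_assoc absorb2[OF u(1)] absorb2[OF u(2)] absorb3[OF uxu] xux)
  have "e = e ** x ** u"
    by (simp add: mult_right_assoc u)
  then have "(e, e ** x) \<in> green_R M"
    using e x \<open>u \<in> M\<close> mult by (auto simp: green_R_iff)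
  moreover have "x = (x ** u) ** (e ** x)"
    by (simp add: mult_right_assoc absorb2[OF u(2)] xux)
  then have "(e ** x, x) \<in> green_L M"
    using e x \<open>u \<in> M\<close> mult by (auto simp: green_L_iff)
  ultimately show "(e, x) \<in> green_D M"
    using green_D_trans green_D_L green_D_R by blast
qed

text \<open>The inverse construction: the idempotent with the image of \<open>k\<close> and the kernel of \<open>h\<close>. It satisfies
  the conditions of \<open>idempotent_near\<close> automatically.\<close>
lemma idempotent_from_pair:
  fixes k h :: "complex ^ 'n ^ 'n"
  assumes e: "e \<in> M" "e ** e = e" and k: "k \<in> left_idempotents M e" and h: "h \<in> right_idempotents M e"
    and cu: "corner_unit e (h ** k)"
  defines "x \<equiv> k ** (corner_inv e (h ** k) ** h)"
  shows "x \<in> M" "x ** x = x" "corner_unit e x" "det (mat 1 - (x - x ** (corner_inv e x ** x))) \<noteq> 0"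
    "x ** corner_inv e x = k" "corner_inv e x ** x = h"
proof -
  define w where "w = corner_inv e (h ** k)"
  have x: "x = k ** (w ** h)"
    by (simp add: x_def w_def)
  have k': "k \<in> M" "e ** k = e" "k ** e = k" "k ** k = k"
    using k left_idempotents_idem[OF k] by (auto simp: left_idempotents_def)
  have h': "h \<in> M" "e ** h = h" "h ** e = e" "h ** h = h"
    using h right_idempotents_idem[OF h] by (auto simp: right_idempotents_def)
  have "w \<in> M"
    unfolding w_def by (intro corner_inv_mem e mult k' h' cu)
  note w = corner_inv[OF e(2) cu, folded w_def, unfolded mult_right_assoc]
  have whk: "w ** (h ** k) = e" and hkw: "h ** (k ** w) = e"
    using w(3,4) by (simp_all add: k' absorb2[OF h'(2)])
  show "x \<in> M"
    unfolding x by (intro mult k' h' \<open>w \<in> M\<close>)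
  show "x ** x = x"
    by (simp add: x mult_right_assoc absorb3[OF whk] absorb2[OF w(1)])
  have "corner_unit e x \<and> corner_inv e x = h ** k"
    using corner_invI[of e "h ** k" x] e k' h'
    by (simp add: x mult_right_assoc absorb2[OF h'(2)] absorb2[OF h'(4)] absorb2[OF k'(2)] absorb2[OF w(1)] whk)
  then show "corner_unit e x" and ci: "corner_inv e x ** x = h" and "x ** corner_inv e x = k"
    by (simp_all add: x mult_right_assoc absorb2[OF k'(4)] absorb2[OF h'(4)] absorb3[OF hkw] h' whk k')
  have "x - x ** (corner_inv e x ** x) = 0"
    unfolding ci by (simp add: x mult_right_assoc h')
  then show "det (mat 1 - (x - x ** (corner_inv e x ** x))) \<noteq> 0"
    by simp
qed

lemma germ_iso_D_class:
  assumes e: "e \<in> M" "e ** e = e"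
  shows "germ_iso (entries ` idempotents (D_class M e)) (entries e)
    (germ_prod (entries ` left_idempotents M e) (entries ` right_idempotents M e)) (vec_pair (entries e) (entries e))"
proof -
  let ?D = "idempotents (D_class M e)"
  let ?u = "\<lambda>x. corner_inv e (unentries x)"
  define U0 where "U0 = {x. corner_unit e (unentries x)}"
  define near where "near x = det (mat 1 - (unentries x - unentries x ** (?u x ** unentries x)))" for x
  define U where "U = {x \<in> U0. near x \<noteq> 0}"
  define F where "F x = vec_pair (entries (unentries x ** ?u x)) (entries (?u x ** unentries x))" for x
  let ?k = "\<lambda>z. unentries (vec_left z)" and ?h = "\<lambda>z. unentries (vec_right z)"
  define V where "V = {z. corner_unit e (?h z ** ?k z)}"
  define G where "G z = entries (?k z ** (corner_inv e (?h z ** ?k z) ** ?h z))" for z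
  have un: "hol_matrix_on W unentries" for W :: "(complex ^ ('n \<times> 'n)) set"
    by (intro hol_matrix_on_unentries hol_map_on_id)
  note c0 = corner_hol[OF un open_UNIV, of e, simplified, folded U0_def]
  have "hol_matrix_on U0 (\<lambda>x. mat 1 - (unentries x - unentries x ** (?u x ** unentries x)))"
    by (intro hol_matrix_on_diff hol_matrix_on_mult hol_matrix_on_const un c0)
  then have "hol_fun_on U0 near"
    unfolding near_def hol_matrix_on_def by (intro hol_fun_on_det) blast
  then have "open U"
    unfolding U_def using c0(1) by (rule open_hol_nonzero)
  have holF: "hol_map_on U F"
    unfolding F_def
    by (rule hol_map_on_subset[of U0], intro hol_map_on_vec_pair hol_map_on_entries hol_matrix_on_mult un c0)
       (auto simp: U_def)
  have kh: "hol_matrix_on W ?k" "hol_matrix_on W ?h" for W :: "(complex ^ ('n \<times> 'n + 'n \<times> 'n)) set"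
    by (intro hol_matrix_on_unentries hol_map_on_vec_left hol_map_on_vec_right)+
  note c1 = corner_hol[OF hol_matrix_on_mult[OF kh(2,1)] open_UNIV, of e, simplified, folded V_def]
  have holG: "hol_map_on V G"
    unfolding G_def by (intro hol_map_on_entries hol_matrix_on_mult kh c1)
  have ce: "corner_unit e e" "corner_inv e e = e"
    using corner_invI[of e e e] e by auto
  have "(e, e) \<in> green_D M"
    by (rule green_D_L) (use e in \<open>auto simp: green_L_def\<close>)
  show ?thesis
  proof (rule germ_isoI[OF \<open>open U\<close> c1(1) _ _ _ _ holF holG])
    show "entries e \<in> entries ` ?D"
      using e \<open>(e, e) \<in> green_D M\<close> by (auto simp: idempotents_def D_class_def)
    show "entries e \<in> U"
      by (simp add: U_def U0_def near_def ce e)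
    show "vec_pair (entries e) (entries e) \<in> germ_prod (entries ` left_idempotents M e) (entries ` right_idempotents M e)"
      using e by (auto simp: germ_prod_def left_idempotents_def right_idempotents_def)
    show "vec_pair (entries e) (entries e) \<in> V"
      by (simp add: V_def ce e)
    show "F (entries e) = vec_pair (entries e) (entries e)"
      by (simp add: F_def ce e)
  next
    fix x assume "x \<in> entries ` ?D" "x \<in> U"
    then obtain X where X: "x = entries X" "X \<in> M" "X ** X = X" "corner_unit e X"
        "det (mat 1 - (X - X ** (corner_inv e X ** X))) \<noteq> 0"
      using green_D_mem by (auto simp: idempotents_def D_class_def U_def U0_def near_def)
    from idempotent_near[OF e X(2-)] show "F x \<in> germ_prod (entries ` left_idempotents M e) (entries ` right_idempotents M e)
        \<and> F x \<in> V \<and> G (F x) = x"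
      by (simp add: F_def G_def V_def germ_prod_def X(1) in_entries_image_iff)
  next
    fix z assume "z \<in> germ_prod (entries ` left_idempotents M e) (entries ` right_idempotents M e)" "z \<in> V"
    then have kh: "?k z \<in> left_idempotents M e" "?h z \<in> right_idempotents M e" "corner_unit e (?h z ** ?k z)"
      by (auto simp: germ_prod_def V_def in_entries_image_iff)
    define X where "X = ?k z ** (corner_inv e (?h z ** ?k z) ** ?h z)"
    note X = idempotent_from_pair[OF e kh, folded X_def]
    have "(e, X) \<in> green_D M"
      by (rule idempotent_near(5)[OF e X(1-4)])
    then show "G z \<in> entries ` ?D \<and> G z \<in> U \<and> F (G z) = z"
      using X by (simp add: G_def X_def[symmetric] F_def U_def U0_def near_def idempotents_def D_class_def)
  qed
qed

end

theorem (in regular_irreducible_monoid) D_class_manifold: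
  assumes e: "e \<in> M" "e ** e = e" and f: "f \<in> idempotents (D_class M e)"
  shows "manifold_at (left_dim M e + right_dim M e) (entries ` idempotents (D_class M e)) (entries f)"
proof -
  have ef: "(e, f) \<in> green_D M" and f': "f \<in> M" "f ** f = f"
    using f green_D_mem by (auto simp: idempotents_def D_class_def)
  have "D_class M f = D_class M e"
    unfolding D_class_def using ef green_D_trans green_D_sym by blast
  moreover have "manifold_at (left_dim M f) (entries ` left_idempotents M f) (entries f)"
    using f' by (intro left_idempotents_manifold) (auto simp: left_idempotents_def)
  moreover have "manifold_at (right_dim M f) (entries ` right_idempotents M f) (entries f)"
    using f' by (intro right_idempotents_manifold) (auto simp: right_idempotents_def)
  ultimately show ?thesis
    using manifold_at_prod[OF germ_iso_D_class[OF f']] dims_D_class[OF ef e(2) f'(2)] by simp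
qed

theorem theorem5p8:
  fixes M :: "(complex ^ 'n ^ 'n) set" and e :: "complex ^ 'n ^ 'n"
  assumes "algebraic_submonoid M"
    and "irreducible_submonoid M"
    and "regular_submonoid M"
    and "e \<in> idempotents M"
  shows "(\<exists>d. complex_submanifold d (entries ` idempotents (D_class M e))) \<and>
    (\<exists>d. complex_submanifold d (entries ` idempotents (L_class M e))) \<and>
    (\<exists>d. complex_submanifold d (entries ` idempotents (R_class M e))) \<and>
    complex_dim (entries ` idempotents (D_class M e)) =
      complex_dim (entries ` idempotents (L_class M e)) +
      complex_dim (entries ` idempotents (R_class M e))"
proof -
  have alg: "algebraic_set (entries ` M)" and sub: "mat 1 \<in> M" "\<And>a b. a \<in> M \<Longrightarrow> b \<in> M \<Longrightarrow> a ** b \<in> M"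
    using assms(1) by (auto simp: algebraic_submonoid_def matrix_submonoid_def)
  interpret regular_irreducible_monoid M
  proof
    show "\<exists>x\<in>M. a ** (x ** a) = a" if "a \<in> M" for a
      using assms(3) that unfolding regular_submonoid_def by (simp add: matrix_mul_assoc)
    show "\<exists>c\<in>M. p (entries c) \<noteq> 0 \<and> q (entries c) \<noteq> 0"
      if "polynomial_fun p" "polynomial_fun q" "a \<in> M" "p (entries a) \<noteq> 0" "b \<in> M" "q (entries b) \<noteq> 0" for p q a b
      using irreducible_generic[OF alg assms(2)[unfolded irreducible_submonoid_def] that(1,2), of "entries a" "entries b"]
        that(3-) by auto
  qed (use alg sub in auto)
  have e: "e \<in> M" "e ** e = e"
    using assms(4) by (auto simp: idempotents_def)
  have L: "manifold_at (left_dim M e) (entries ` idempotents (L_class M e)) p"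
    if "p \<in> entries ` idempotents (L_class M e)" for p
    using that left_idempotents_manifold[OF e] unfolding idempotents_L_class[OF e] by blast
  have R: "manifold_at (right_dim M e) (entries ` idempotents (R_class M e)) p"
    if "p \<in> entries ` idempotents (R_class M e)" for p
    using that right_idempotents_manifold[OF e] unfolding idempotents_R_class[OF e] by blast
  have D: "manifold_at (left_dim M e + right_dim M e) (entries ` idempotents (D_class M e)) p"
    if "p \<in> entries ` idempotents (D_class M e)" for p
    using that D_class_manifold[OF e] by blast
  have "(e, e) \<in> green_L M" "(e, e) \<in> green_R M"
    using e by (auto simp: green_L_def green_R_def)
  then have "e \<in> idempotents (L_class M e)" "e \<in> idempotents (R_class M e)" "e \<in> idempotents (D_class M e)"
    using e green_D_L by (auto simp: idempotents_def L_class_def R_class_def D_class_def)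
  then have "complex_dim (entries ` idempotents (L_class M e)) = left_dim M e"
    "complex_dim (entries ` idempotents (R_class M e)) = right_dim M e"
    "complex_dim (entries ` idempotents (D_class M e)) = left_dim M e + right_dim M e"
    using L R D by (auto intro!: complex_dim_eq)
  moreover have "complex_submanifold (left_dim M e) (entries ` idempotents (L_class M e))"
    using L by (rule complex_submanifoldI)
  moreover have "complex_submanifold (right_dim M e) (entries ` idempotents (R_class M e))"
    using R by (rule complex_submanifoldI)
  moreover have "complex_submanifold (left_dim M e + right_dim M e) (entries ` idempotents (D_class M e))"
    using D by (rule complex_submanifoldI)
  ultimately show ?thesis
    by auto
qed

end
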